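(* Let $A:L_2(\mathcal{X})\to L_2(\tilde{\mathcal{X}})$ be a known linear compact operator with singular value decomposition $A\phi_k=b_k\psi_k$, $A^*\psi_k=b_k\phi_k$, $k\ge1$. Suppose that $\{\ell(g)-\ell(g^* ):g\in\mathcal{G}\}$ is a Bernstein class with respect to $\nu_Y$ with parameter $\kappa\ge1$ and that $\ell(g(\cdot),y)\in L_2(\nu)$ for any $y\in\mathcal{Y}$ (and $g\in\mathcal{G}$). Suppose there exists $0<\rho<1$ such that $$\tilde\omega_n(\mathcal{G},\delta,\nu_Y)\le C_1\frac{c(N)}{\sqrt n}\,\delta^{1-\rho},\qquad\forall\,0<\delta<1,$$ for some $C_1>0$, where $c(N)=N^\beta$. Assume that $b_k\sim k^{-\beta}$ as $k\to+\infty$ for some $\beta\in\mathbb{R}_+$, and that $f_y\in\mathcal{P}(\gamma,L)$ for every $y\in\mathcal{Y}$. Then $\hat g_n^N\in\arg\min_{g\in\mathcal{G}}\frac1n\sum_{i=1}^n\ell_N(g,Z_i,Y_i)$ with $$N=n^{\frac{2\kappa-1}{2\gamma(2\kappa+\rho-1)+2(2\kappa-1)\beta}}$$ satisfies, for $n$ large enough, $$\sup_{f_y\in\mathcal{P}(\gamma,L)}\mathbb{E}R_\ell(\hat g_n^N)-R_\ell(g^* )\le C\,n^{-\frac{\kappa\gamma}{\gamma(2\kappa+\rho-1)+(2\kappa-1)\beta}}$$ for some constant $C>0$ not depending on $n$.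
   Context: Setting. $\mathcal{Y}=\{0,1,\dots,M\}$, $M\ge1$; $\mathcal{X},\tilde{\mathcal{X}}\subseteq\mathbb{R}^d$, $L_2$ spaces are with respect to a $\sigma$-finite measure $\nu$. $(X,Y)\in\mathcal{X}\times\mathcal{Y}$ has law $P$; $p_y=\mathbb{P}(Y=y)$ and $f_y$ is the conditional density of $X$ given $Y=y$ w.r.t. $\nu$. One observes i.i.d. $(Z_i,Y_i)$, $i=1,\dots,n$, with law $\tilde P$, where $Z$ given $Y=y$ has density $Af_y$ with respect to $\nu$. $\tilde P_n=\frac1n\sum_{i=1}^n\delta_{(Z_i,Y_i)}$. $\mathcal{G}$ is a class of measurable functions $g:\mathcal{X}\to\mathbb{R}$; $\ell:\mathbb{R}\times\mathcal{Y}\to[0,1]$ is a loss; $\ell(g)$ denotes $(x,y)\mapsto\ell(g(x),y)$; $R_\ell(g)=\mathbb{E}_P\ell(g(X),Y)$; $g^*$ is the minimizer of $R_\ell$ over $\mathcal{G}$. Minimizers are assumed to exist. $\nu_Y=\nu\otimes P_Y$, i.e. $\|h\|_{L_2(\nu_Y)}^2=\sum_{y}p_y\int h(x,y)^2\nu(dx)$. Bernstein class: $\mathcal{F}$ is a Bernstein class with respect to $\mu$ with parameter $\kappa\ge1$ if there is $\kappa_0\ge0$ with $\|f\|_{L_2(\mu)}^2\le\kappa_0[\mathbb{E}_Pf]^{1/\kappa}$ for all $f\in\mathcal{F}$. SVD: $(\phi_k)_{k\ge1}$ is an orthonormal basis of eigenfunctions of $A^*A$, $A^*A\phi_k=b_k^2\phi_k$,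 with $(b_k)_{k\ge1}$ the decreasing sequence of (positive) singular values and $\psi_k=A\phi_k/b_k$. Spectral cut-off loss: for an integer $N\ge1$, $$\ell_N(g,z,y)=\sum_{k=1}^Nb_k^{-1}\left(\int_{\mathcal{X}}\phi_k(x)\ell(g(x),y)\nu(dx)\right)\psi_k(z),$$ and $\ell_N(g)$ denotes $(z,y)\mapsto\ell_N(g,z,y)$. (It corresponds to estimating $f_y$ by $\sum_{k\le N}\hat\theta_k^y\phi_k$, with $\hat\theta_k^y$ the unbiased estimator of $\theta_k^y=\int f_y\phi_kd\nu$ given by the average of $b_k^{-1}\psi_k(Z_i)$ over the indices $i$ with $Y_i=y$.) The prescribed value of $N$ is understood up to rounding to an integer. Complexity: $\tilde\omega_n(\mathcal{G},\delta,\mu)=\mathbb{E}\sup\left\{\left|(\tilde P-\tilde P_n)(\ell_N(g)-\ell_N(g'))\right|:g,g'\in\mathcal{G},\ \|\ell(g)-\ell(g')\|_{L_2(\mu)}\le\delta\right\}$. Regularity: $\mathcal{P}(\gamma,L)$ is the set of bounded probability densities in the ellipsoid $\Theta(\gamma,L)=\{f=\sum_{k\ge1}\theta_k\phi_k:\sum_{k\ge1}\theta_k^2k^{2\gamma}\le L\}$, with $\gamma,L>0$. The supremum over $f_y\in\mathcal{P}(\gamma,L)$ is over conditional densities $(f_y)_{y\in\mathcal{Y}}$ in $\mathcal{P}(\gamma,L)$ for which the other hypotheses hold, with fixed constants.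
   Formalization: The complexity bound is assumed for all n and N, and not only for 0<δ<1 but also, when the Bernstein constant κ_0≥1, for 1≤δ≤√κ_0; with δ<1 alone the claim fails, as a class whose losses are at mutual distance ≥1 satisfies it trivially. *)

theory Defs
  imports "HOL-Probability.Probability" "HOL-Library.Landau_Symbols"
begin

text \<open>
  Elements of \<open>L\<^sub>2\<close> are represented by functions; identities between them are identities
  almost everywhere, and operators on \<open>L\<^sub>2\<close> act on representatives.
\<close>

definition L2 :: "'a measure \<Rightarrow> ('a \<Rightarrow> real) set" where
  "L2 M = {f \<in> borel_measurable M. integrable M (\<lambda>x. (f x)\<^sup>2)}"

definition L2_inner :: "'a measure \<Rightarrow> ('a \<Rightarrow> real) \<Rightarrow> ('a \<Rightarrow> real) \<Rightarrow> real" where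
  "L2_inner M f g = (\<integral>x. f x * g x \<partial>M)"

definition L2_norm :: "'a measure \<Rightarrow> ('a \<Rightarrow> real) \<Rightarrow> real" where
  "L2_norm M f = sqrt (\<integral>x. (f x)\<^sup>2 \<partial>M)"

definition L2_linear ::
    "'a measure \<Rightarrow> 'b measure \<Rightarrow> (('a \<Rightarrow> real) \<Rightarrow> ('b \<Rightarrow> real)) \<Rightarrow> bool" where
  "L2_linear M N A \<longleftrightarrow>
     (\<forall>f\<in>L2 M. A f \<in> L2 N) \<and>
     (\<forall>f\<in>L2 M. \<forall>g\<in>L2 M. (AE x in M. f x = g x) \<longrightarrow> (AE z in N. A f z = A g z)) \<and>
     (\<forall>f\<in>L2 M. \<forall>g\<in>L2 M. \<forall>r s.
        AE z in N. A (\<lambda>x. r * f x + s * g x) z = r * A f z + s * A g z)"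

definition L2_compact ::
    "'a measure \<Rightarrow> 'b measure \<Rightarrow> (('a \<Rightarrow> real) \<Rightarrow> ('b \<Rightarrow> real)) \<Rightarrow> bool" where
  "L2_compact M N A \<longleftrightarrow>
     (\<forall>u :: nat \<Rightarrow> 'a \<Rightarrow> real.
        (\<forall>j. u j \<in> L2 M) \<and> (\<exists>B. \<forall>j. L2_norm M (u j) \<le> B) \<longrightarrow>
        (\<exists>r h. strict_mono (r :: nat \<Rightarrow> nat) \<and> h \<in> L2 N \<and>
           (\<lambda>j. L2_norm N (\<lambda>z. A (u (r j)) z - h z)) \<longlonglongrightarrow> 0))"

definition L2_adjoint ::
    "'a measure \<Rightarrow> 'b measure \<Rightarrow> (('a \<Rightarrow> real) \<Rightarrow> ('b \<Rightarrow> real)) \<Rightarrow>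
     (('b \<Rightarrow> real) \<Rightarrow> ('a \<Rightarrow> real)) \<Rightarrow> bool" where
  "L2_adjoint M N A A' \<longleftrightarrow>
     L2_linear N M A' \<and>
     (\<forall>f\<in>L2 M. \<forall>h\<in>L2 N. L2_inner N (A f) h = L2_inner M f (A' h))"

text \<open>Sequences of basis functions and of singular values are indexed by \<open>k \<ge> 1\<close>.\<close>

definition orthonormal_basis :: "'a measure \<Rightarrow> (nat \<Rightarrow> 'a \<Rightarrow> real) \<Rightarrow> bool" where
  "orthonormal_basis M \<phi> \<longleftrightarrow>
     (\<forall>k\<ge>1. \<phi> k \<in> L2 M) \<and>
     (\<forall>j\<ge>1. \<forall>k\<ge>1. L2_inner M (\<phi> j) (\<phi> k) = (if j = k then 1 else 0)) \<and>
     (\<forall>h\<in>L2 M. (\<forall>k\<ge>1. L2_inner M h (\<phi> k) = 0) \<longrightarrow> (AE x in M. h x = 0))"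

text \<open>
  The eigenvalue equations \<open>A\<^sup>* A \<phi>\<^sub>k = b\<^sub>k\<^sup>2 \<phi>\<^sub>k\<close> and the orthonormality of \<open>(\<psi>\<^sub>k)\<close>
  follow from the clauses below.
\<close>

definition singular_value_decomposition ::
    "'a measure \<Rightarrow> 'b measure \<Rightarrow> (('a \<Rightarrow> real) \<Rightarrow> ('b \<Rightarrow> real)) \<Rightarrow>
     (('b \<Rightarrow> real) \<Rightarrow> ('a \<Rightarrow> real)) \<Rightarrow>
     (nat \<Rightarrow> real) \<Rightarrow> (nat \<Rightarrow> 'a \<Rightarrow> real) \<Rightarrow> (nat \<Rightarrow> 'b \<Rightarrow> real) \<Rightarrow> bool" where
  "singular_value_decomposition M N A A' b \<phi> \<psi> \<longleftrightarrow>
     orthonormal_basis M \<phi> \<and>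
     (\<forall>k\<ge>1. \<psi> k \<in> L2 N \<and> b k > 0 \<and>
        (AE z in N. A (\<phi> k) z = b k * \<psi> k z) \<and>
        (AE x in M. A' (\<psi> k) x = b k * \<phi> k x)) \<and>
     (\<forall>j\<ge>1. \<forall>k\<ge>j. b k \<le> b j)"

definition prob_density :: "'a measure \<Rightarrow> ('a \<Rightarrow> real) \<Rightarrow> bool" where
  "prob_density M f \<longleftrightarrow> (AE x in M. 0 \<le> f x) \<and> has_bochner_integral M f 1"

definition ellipsoid ::
    "'a measure \<Rightarrow> (nat \<Rightarrow> 'a \<Rightarrow> real) \<Rightarrow> real \<Rightarrow> real \<Rightarrow> ('a \<Rightarrow> real) set" where
  "ellipsoid M \<phi> \<gamma> L =
     {f \<in> L2 M. \<exists>\<theta> :: nat \<Rightarrow> real.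
        (\<lambda>m. L2_norm M (\<lambda>x. f x - (\<Sum>k=1..m. \<theta> k * \<phi> k x))) \<longlonglongrightarrow> 0 \<and>
        (\<lambda>k. (\<theta> k)\<^sup>2 * real k powr (2 * \<gamma>)) summable_on {1..} \<and>
        (\<Sum>\<^sub>\<infinity>k\<in>{1..}. (\<theta> k)\<^sup>2 * real k powr (2 * \<gamma>)) \<le> L}"

definition regular_densities ::
    "'a measure \<Rightarrow> (nat \<Rightarrow> 'a \<Rightarrow> real) \<Rightarrow> real \<Rightarrow> real \<Rightarrow> ('a \<Rightarrow> real) set" where
  "regular_densities M \<phi> \<gamma> L =
     {f \<in> ellipsoid M \<phi> \<gamma> L. prob_density M f \<and> (\<exists>B. AE x in M. f x \<le> B)}"

definition label_law :: "nat \<Rightarrow> (nat \<Rightarrow> real) \<Rightarrow> nat measure" where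
  "label_law M p = point_measure {..M} (\<lambda>y. ennreal (p y))"

text \<open>
  The law of a pair whose label \<open>y\<close> has probability \<open>p y\<close> and whose first component
  has, given the label \<open>y\<close>, density \<open>f y\<close> with respect to \<open>\<nu>\<close>.
\<close>

definition joint_law ::
    "'a measure \<Rightarrow> nat \<Rightarrow> (nat \<Rightarrow> real) \<Rightarrow> (nat \<Rightarrow> 'a \<Rightarrow> real) \<Rightarrow> ('a \<times> nat) measure" where
  "joint_law \<nu> M p f =
     density (\<nu> \<Otimes>\<^sub>M label_law M p) (\<lambda>(x, y). ennreal (f y x))"

definition loss_of ::
    "(real \<Rightarrow> nat \<Rightarrow> real) \<Rightarrow> ('a \<Rightarrow> real) \<Rightarrow> 'a \<times> nat \<Rightarrow> real" where
  "loss_of loss g = (\<lambda>(x, y). loss (g x) y)"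

definition risk ::
    "(real \<Rightarrow> nat \<Rightarrow> real) \<Rightarrow> ('a \<times> nat) measure \<Rightarrow> ('a \<Rightarrow> real) \<Rightarrow> real" where
  "risk loss P g = (\<integral>w. loss_of loss g w \<partial>P)"

text \<open>
  For a class of excess losses with values in \<open>[-1, 1]\<close> the condition bounds the
  \<open>L\<^sub>2(\<mu>)\<close>-norms by \<open>sqrt \<kappa>\<^sub>0\<close>, which exceeds \<open>1\<close> if \<open>\<kappa>\<^sub>0 > 1\<close>: complexity bounds at
  radii below \<open>1\<close> only do not control such a class.
\<close>

definition bernstein_class ::
    "'b measure \<Rightarrow> 'b measure \<Rightarrow> real \<Rightarrow> real \<Rightarrow> ('b \<Rightarrow> real) set \<Rightarrow> bool" where
  "bernstein_class P \<mu> \<kappa> \<kappa>\<^sub>0 F \<longleftrightarrow>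
     (\<forall>f\<in>F. (L2_norm \<mu> f)\<^sup>2 \<le> \<kappa>\<^sub>0 * (\<integral>w. f w \<partial>P) powr (1 / \<kappa>))"

definition cutoff_loss ::
    "'a measure \<Rightarrow> (nat \<Rightarrow> real) \<Rightarrow> (nat \<Rightarrow> 'a \<Rightarrow> real) \<Rightarrow> (nat \<Rightarrow> 'b \<Rightarrow> real) \<Rightarrow>
     (real \<Rightarrow> nat \<Rightarrow> real) \<Rightarrow> nat \<Rightarrow> ('a \<Rightarrow> real) \<Rightarrow> 'b \<times> nat \<Rightarrow> real" where
  "cutoff_loss \<nu> b \<phi> \<psi> loss N g =
     (\<lambda>(z, y). \<Sum>k=1..N. inverse (b k) * (\<integral>x. \<phi> k x * loss (g x) y \<partial>\<nu>) * \<psi> k z)"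

definition emp_mean :: "nat \<Rightarrow> (nat \<Rightarrow> 'b) \<Rightarrow> ('b \<Rightarrow> real) \<Rightarrow> real" where
  "emp_mean n s h = (\<Sum>i<n. h (s i)) / real n"

text \<open>
  The expected supremum of the empirical process of a sample \<open>s\<close> of size \<open>n\<close> from \<open>Q\<close>,
  indexed by the increments \<open>T g - T g'\<close>, localised by the \<open>L\<^sub>2(\<mu>)\<close>-distance of
  \<open>l g\<close> and \<open>l g'\<close>. It takes its values in \<open>[0, \<infinity>]\<close>. For \<open>T\<close> a cut-off loss the
  supremum is a measurable function of the sample, since the increments lie in a
  finite-dimensional space.
\<close>

definition expected_modulus ::
    "'b measure \<Rightarrow> nat \<Rightarrow> 'c measure \<Rightarrow> 'g set \<Rightarrow> ('g \<Rightarrow> 'c \<Rightarrow> real) \<Rightarrow>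
     ('g \<Rightarrow> 'b \<Rightarrow> real) \<Rightarrow> real \<Rightarrow> ennreal" where
  "expected_modulus Q n \<mu> G l T \<delta> =
     (\<integral>\<^sup>+ s. (\<Squnion>(g, g') \<in> {(g, g'). g \<in> G \<and> g' \<in> G \<and> L2_norm \<mu> (\<lambda>w. l g w - l g' w) \<le> \<delta>}.
        ennreal \<bar>(\<integral>w. T g w - T g' w \<partial>Q) - emp_mean n s (\<lambda>w. T g w - T g' w)\<bar>)
      \<partial>(\<Pi>\<^sub>M i\<in>{..<n}. Q))"

end

theory Submission
  imports Defs
begin

text \<open>
  For a fixed \<open>g\<close>, the excess risk and the mean of \<open>\<ell>\<^sub>N(g) - \<ell>\<^sub>N(g\<^sup>*)\<close> differ by at most
  \<open>sqrt L N powr (- \<gamma>) \<parallel>\<ell>(g) - \<ell>(g\<^sup>*)\<parallel>\<close>, since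
  the singular value decomposition makes \<open>\<ell>\<^sub>N\<close> unbiased for the first \<open>N\<close> coefficients of \<open>f\<^sub>y\<close>.
  By the Bernstein condition the excess risk \<open>r\<close> of the empirical minimizer thus satisfies
  \<open>r \<le> B r powr (1 / (2 \<kappa>)) + S(\<delta>)\<close>, where \<open>S(\<delta>)\<close> is the supremum of the empirical
  process over increments of radius \<open>\<delta> \<approx> r powr (1 / (2 \<kappa>))\<close>.

  The hypothesis bounds only the mean of \<open>S(\<delta>)\<close>, and the increments may be unbounded, so that
  concentration inequalities do not apply. But the bound holds for all sample sizes at
  once, which yields a weak second moment: \<open>P(S(\<delta>) > u) \<le> 32 (a(\<delta>) / u)\<^sup>2\<close>, where \<open>a(\<delta>)\<close> is
  the bound on the mean. Summing over dyadic shells \<open>2\<^sup>j s < r \<le> 2\<^sup>j\<^sup>+\<^sup>1 s\<close> gives a convergent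
  geometric series because \<open>\<kappa> > 1 - \<rho>\<close>; its size is that of the first shell \<open>s\<close>, at
  which bias and noise balance.
\<close>

section \<open>Empirical sums indexed by a centred class\<close>

text \<open>Values lie in \<open>ennreal\<close> because the class may be uncountable and unbounded.
  The index set is left free so that initial segments and blocks of one sample can be
  compared.\<close>

definition sup_sum :: "('a \<Rightarrow> real) set \<Rightarrow> nat set \<Rightarrow> (nat \<Rightarrow> 'a) \<Rightarrow> ennreal" where
  "sup_sum H I s = (\<Squnion>h\<in>H. ennreal \<bar>\<Sum>i\<in>I. h (s i)\<bar>)"

lemma sup_sum_cong: "(\<And>i. i \<in> I \<Longrightarrow> s i = t i) \<Longrightarrow> sup_sum H I s = sup_sum H I t"
  unfolding sup_sum_def by (intro SUP_cong refl arg_cong[where f=ennreal] arg_cong[where f=abs] sum.cong) auto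

text \<open>A block is a difference of two initial segments; the triangle inequality transfers the
  maximal inequality from segments to blocks.\<close>

lemma sup_sum_le_add:
  assumes "finite I" "J \<subseteq> I"
  shows "sup_sum H (I - J) s \<le> sup_sum H I s + sup_sum H J s"
proof -
  have "ennreal \<bar>\<Sum>i\<in>I - J. h (s i)\<bar> \<le> sup_sum H I s + sup_sum H J s" if "h \<in> H" for h
  proof -
    have "\<bar>\<Sum>i\<in>I - J. h (s i)\<bar> \<le> \<bar>\<Sum>i\<in>I. h (s i)\<bar> + \<bar>\<Sum>i\<in>J. h (s i)\<bar>"
      using assms by (simp add: sum_diff)
    then have "ennreal \<bar>\<Sum>i\<in>I - J. h (s i)\<bar> \<le> ennreal \<bar>\<Sum>i\<in>I. h (s i)\<bar> + ennreal \<bar>\<Sum>i\<in>J. h (s i)\<bar>"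
      by (metis abs_ge_zero ennreal_leI ennreal_plus)
    also have "\<dots> \<le> sup_sum H I s + sup_sum H J s"
      unfolding sup_sum_def using that by (intro add_mono SUP_upper)
    finally show ?thesis .
  qed
  then show ?thesis by (subst sup_sum_def) (rule SUP_least)
qed

text \<open>A supremum over an uncountable class may fail to be measurable, hence the last
  assumption. It allows \<open>I \<subseteq> J\<close> since partial sums are integrated over the
  full sample.\<close>

locale centred_class = prob_space Q for Q :: "'a measure" +
  fixes H :: "('a \<Rightarrow> real) set"
  assumes integrable_class: "h \<in> H \<Longrightarrow> integrable Q h"
    and mean_zero: "h \<in> H \<Longrightarrow> (\<integral>x. h x \<partial>Q) = 0"
    and sup_sum_measurable:
      "finite J \<Longrightarrow> I \<subseteq> J \<Longrightarrow> sup_sum H I \<in> borel_measurable (\<Pi>\<^sub>M i\<in>J. Q)"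
begin

section \<open>Submartingale property and maximal inequality\<close>

lemma prob_space_sample: "prob_space (\<Pi>\<^sub>M i\<in>I. Q)"
  by (intro prob_space_PiM prob_space_axioms)

lemma integral_component:
  assumes "h \<in> H" "j \<in> J"
  shows "integrable (\<Pi>\<^sub>M i\<in>J. Q) (\<lambda>s. h (s j))" "(\<integral>s. h (s j) \<partial>(\<Pi>\<^sub>M i\<in>J. Q)) = 0"
proof -
  have d: "distr (\<Pi>\<^sub>M i\<in>J. Q) Q (\<lambda>s. s j) = Q"
    using assms by (intro distr_PiM_component prob_space_axioms)
  have "integrable (distr (\<Pi>\<^sub>M i\<in>J. Q) Q (\<lambda>s. s j)) h"
    unfolding d using integrable_class[OF assms(1)] .
  then show "integrable (\<Pi>\<^sub>M i\<in>J. Q) (\<lambda>s. h (s j))"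
    by (rule integrable_distr[rotated]) (use assms in measurable)
  have "(\<integral>s. h (s j) \<partial>(\<Pi>\<^sub>M i\<in>J. Q)) = (\<integral>x. h x \<partial>distr (\<Pi>\<^sub>M i\<in>J. Q) Q (\<lambda>s. s j))"
    using assms integrable_class[OF assms(1)] by (intro integral_distr[symmetric]) auto
  then show "(\<integral>s. h (s j) \<partial>(\<Pi>\<^sub>M i\<in>J. Q)) = 0"
    using d mean_zero[OF assms(1)] by simp
qed

text \<open>Jensen's inequality: the fresh coordinates in \<open>J\<close> have mean zero, so
  integrating them out of the full sum leaves the partial sum, and a supremum of means is at most
  the mean of the supremum.\<close>

lemma sup_sum_le_average:
  assumes fin: "finite I" "finite J" and disj: "I \<inter> J = {}"
  shows "sup_sum H I x \<le> (\<integral>\<^sup>+ y. sup_sum H (I \<union> J) (merge I J (x, y)) \<partial>(\<Pi>\<^sub>M i\<in>J. Q))"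
  unfolding sup_sum_def[of H I]
proof (rule SUP_least)
  fix h assume h: "h \<in> H"
  interpret J: prob_space "\<Pi>\<^sub>M i\<in>J. Q" by (rule prob_space_sample)
  let ?S = "\<lambda>y. (\<Sum>i\<in>I. h (x i)) + (\<Sum>j\<in>J. h (y j))"
  have int: "integrable (\<Pi>\<^sub>M i\<in>J. Q) ?S"
    by (intro Bochner_Integration.integrable_add Bochner_Integration.integrable_sum
          integral_component(1)[OF h] J.integrable_const) auto
  have "(\<integral>y. ?S y \<partial>(\<Pi>\<^sub>M i\<in>J. Q)) = (\<Sum>i\<in>I. h (x i)) + (\<Sum>j\<in>J. \<integral>y. h (y j) \<partial>(\<Pi>\<^sub>M i\<in>J. Q))"
    by (subst Bochner_Integration.integral_add)
      (auto intro!: Bochner_Integration.integrable_sum integral_component(1)[OF h]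
        simp: Bochner_Integration.integral_sum integral_component(1)[OF h] J.prob_space)
  also have "\<dots> = (\<Sum>i\<in>I. h (x i))" by (simp add: integral_component(2)[OF h])
  finally have "\<bar>\<Sum>i\<in>I. h (x i)\<bar> \<le> (\<integral>y. \<bar>?S y\<bar> \<partial>(\<Pi>\<^sub>M i\<in>J. Q))"
    using integral_abs_bound[of "\<Pi>\<^sub>M i\<in>J. Q" ?S] by simp
  then have "ennreal \<bar>\<Sum>i\<in>I. h (x i)\<bar> \<le> (\<integral>\<^sup>+y. ennreal \<bar>?S y\<bar> \<partial>(\<Pi>\<^sub>M i\<in>J. Q))"
    using int by (subst nn_integral_eq_integral) (auto intro: ennreal_leI)
  also have "\<dots> \<le> (\<integral>\<^sup>+ y. sup_sum H (I \<union> J) (merge I J (x, y)) \<partial>(\<Pi>\<^sub>M i\<in>J. Q))"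
  proof (rule nn_integral_mono)
    fix y
    have "?S y = (\<Sum>i\<in>I \<union> J. h (merge I J (x, y) i))"
      using fin disj by (subst sum.union_disjoint) (auto intro!: arg_cong2[where f="(+)"] sum.cong simp: merge_def)
    then show "ennreal \<bar>?S y\<bar> \<le> sup_sum H (I \<union> J) (merge I J (x, y))"
      unfolding sup_sum_def using h by (auto intro!: SUP_upper2[of h])
  qed
  finally show "ennreal \<bar>\<Sum>i\<in>I. h (x i)\<bar> \<le> (\<integral>\<^sup>+ y. sup_sum H (I \<union> J) (merge I J (x, y)) \<partial>(\<Pi>\<^sub>M i\<in>J. Q))" .
qed

text \<open>The submartingale property without conditional expectations: nonnegative weights
  \<open>G\<close> that see only the coordinates in \<open>I\<close> act as test functions. By
  Tonelli they are constant in the inner integral, where the averaging inequality applies.\<close>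

lemma sup_sum_submartingale:
  assumes fin: "finite I" "finite J" and disj: "I \<inter> J = {}"
    and G[measurable]: "G \<in> borel_measurable (\<Pi>\<^sub>M i\<in>I \<union> J. Q)"
    and dep: "\<And>s t. (\<And>i. i \<in> I \<Longrightarrow> s i = t i) \<Longrightarrow> G s = G t"
  shows "(\<integral>\<^sup>+s. G s * sup_sum H I s \<partial>(\<Pi>\<^sub>M i\<in>I \<union> J. Q))
       \<le> (\<integral>\<^sup>+s. G s * sup_sum H (I \<union> J) s \<partial>(\<Pi>\<^sub>M i\<in>I \<union> J. Q))"
proof -
  interpret product_sigma_finite "\<lambda>_. Q" ..
  interpret J: prob_space "\<Pi>\<^sub>M i\<in>J. Q" by (rule prob_space_sample)
  have [measurable]: "sup_sum H I \<in> borel_measurable (\<Pi>\<^sub>M i\<in>I \<union> J. Q)"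
    "sup_sum H (I \<union> J) \<in> borel_measurable (\<Pi>\<^sub>M i\<in>I \<union> J. Q)"
    using fin by (auto intro!: sup_sum_measurable)
  have "(\<integral>\<^sup>+s. G s * sup_sum H I s \<partial>(\<Pi>\<^sub>M i\<in>I \<union> J. Q))
      = (\<integral>\<^sup>+x. \<integral>\<^sup>+y. G (merge I J (x, y)) * sup_sum H I (merge I J (x, y)) \<partial>(\<Pi>\<^sub>M i\<in>J. Q) \<partial>(\<Pi>\<^sub>M i\<in>I. Q))"
    by (rule product_nn_integral_fold[OF disj fin]) measurable
  also have "\<dots> \<le> (\<integral>\<^sup>+x. \<integral>\<^sup>+y. G (merge I J (x, y)) * sup_sum H (I \<union> J) (merge I J (x, y)) \<partial>(\<Pi>\<^sub>M i\<in>J. Q) \<partial>(\<Pi>\<^sub>M i\<in>I. Q))"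
  proof (rule nn_integral_mono)
    fix x assume [measurable]: "x \<in> space (\<Pi>\<^sub>M i\<in>I. Q)"
    have 1: "G (merge I J (x, y)) = G x" for y by (rule dep) (auto simp: merge_def)
    have 2: "sup_sum H I (merge I J (x, y)) = sup_sum H I x" for y by (rule sup_sum_cong) (auto simp: merge_def)
    have "(\<integral>\<^sup>+y. G (merge I J (x, y)) * sup_sum H I (merge I J (x, y)) \<partial>(\<Pi>\<^sub>M i\<in>J. Q)) = G x * sup_sum H I x"
      unfolding 1 2 by (simp add: J.emeasure_space_1)
    also have "\<dots> \<le> G x * (\<integral>\<^sup>+ y. sup_sum H (I \<union> J) (merge I J (x, y)) \<partial>(\<Pi>\<^sub>M i\<in>J. Q))"
      by (intro mult_left_mono sup_sum_le_average fin disj) auto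
    also have "\<dots> = (\<integral>\<^sup>+y. G (merge I J (x, y)) * sup_sum H (I \<union> J) (merge I J (x, y)) \<partial>(\<Pi>\<^sub>M i\<in>J. Q))"
      unfolding 1 by (rule nn_integral_cmult[symmetric]) measurable
    finally show "(\<integral>\<^sup>+y. G (merge I J (x, y)) * sup_sum H I (merge I J (x, y)) \<partial>(\<Pi>\<^sub>M i\<in>J. Q))
      \<le> (\<integral>\<^sup>+y. G (merge I J (x, y)) * sup_sum H (I \<union> J) (merge I J (x, y)) \<partial>(\<Pi>\<^sub>M i\<in>J. Q))" .
  qed
  also have "\<dots> = (\<integral>\<^sup>+s. G s * sup_sum H (I \<union> J) s \<partial>(\<Pi>\<^sub>M i\<in>I \<union> J. Q))"
    by (rule product_nn_integral_fold[OF disj fin, symmetric]) measurable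
  finally show ?thesis .
qed

text \<open>Doob's argument: split according to the first initial segment whose supremum exceeds
  \<open>v\<close>. This event is determined by the segment, so the submartingale property replaces
  the supremum at passage by the final one.\<close>

lemma maximal_inequality:
  "v * emeasure (\<Pi>\<^sub>M i\<in>{..<K}. Q)
     {s \<in> space (\<Pi>\<^sub>M i\<in>{..<K}. Q). \<exists>i\<le>K. v < sup_sum H {..<i} s}
   \<le> (\<integral>\<^sup>+s. sup_sum H {..<K} s \<partial>(\<Pi>\<^sub>M i\<in>{..<K}. Q))"
proof -
  let ?M = "\<Pi>\<^sub>M i\<in>{..<K}. Q"
  have [measurable]: "i \<le> K \<Longrightarrow> sup_sum H {..<i} \<in> borel_measurable ?M" for i
    by (intro sup_sum_measurable) auto
  \<comment> \<open>This is the indicator of first passage above \<open>v\<close> at time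
    \<open>i\<close>.\<close>
  define G :: "nat \<Rightarrow> (nat \<Rightarrow> 'a) \<Rightarrow> ennreal" where
    "G i s = of_bool (v < sup_sum H {..<i} s \<and> (\<forall>j<i. \<not> v < sup_sum H {..<j} s))" for i s
  have G_meas[measurable]: "G i \<in> borel_measurable ?M" if "i \<le> K" for i
  proof -
    have [measurable]: "sup_sum H {..<j} \<in> borel_measurable ?M" if "j < i" for j
      by (rule sup_sum_measurable) (use that \<open>i \<le> K\<close> in auto)
    have "Measurable.pred ?M (\<lambda>s. v < sup_sum H {..<i} s \<and> (\<forall>j\<in>{..<i}. \<not> v < sup_sum H {..<j} s))"
      using that by (intro pred_intros_logic pred_intros_finite) auto
    then have "(\<lambda>s. if v < sup_sum H {..<i} s \<and> (\<forall>j\<in>{..<i}. \<not> v < sup_sum H {..<j} s) then 1 else (0::ennreal))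
      \<in> borel_measurable ?M" by measurable
    moreover have "G i = (\<lambda>s. if v < sup_sum H {..<i} s \<and> (\<forall>j\<in>{..<i}. \<not> v < sup_sum H {..<j} s) then 1 else 0)"
      by (auto simp: G_def fun_eq_iff)
    ultimately show ?thesis by simp
  qed
  \<comment> \<open>The first-passage events are disjoint; only the summand at the least passage
    index can be nonzero.\<close>
  have G_sum: "(\<Sum>i\<le>K. G i s) = of_bool (\<exists>i\<le>K. v < sup_sum H {..<i} s)" for s
  proof (cases "\<exists>i\<le>K. v < sup_sum H {..<i} s")
    case True
    define i0 where "i0 = (LEAST i. v < sup_sum H {..<i} s)"
    have i0: "v < sup_sum H {..<i0} s" "i0 \<le> K" "\<And>j. j < i0 \<Longrightarrow> \<not> v < sup_sum H {..<j} s"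
      using True unfolding i0_def by (auto intro: LeastI dest: not_less_Least intro: Least_le order_trans)
    have "G i s = (if i = i0 then 1 else 0)" for i
      using i0 by (cases i i0 rule: linorder_cases) (auto simp: G_def)
    then show ?thesis using True i0(2) by simp
  qed (simp add: G_def)
  have "{s \<in> space ?M. \<exists>i\<le>K. v < sup_sum H {..<i} s} = {s \<in> space ?M. \<exists>i\<in>{..K}. v < sup_sum H {..<i} s}"
    by auto
  also have "\<dots> \<in> sets ?M" by (measurable; auto)
  finally have set: "{s \<in> space ?M. \<exists>i\<le>K. v < sup_sum H {..<i} s} \<in> sets ?M" .
  have "v * emeasure ?M {s \<in> space ?M. \<exists>i\<le>K. v < sup_sum H {..<i} s}
      = (\<integral>\<^sup>+s. v * indicator {s \<in> space ?M. \<exists>i\<le>K. v < sup_sum H {..<i} s} s \<partial>?M)"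
    using set by (simp add: nn_integral_cmult_indicator)
  also have "\<dots> = (\<integral>\<^sup>+s. (\<Sum>i\<le>K. v * G i s) \<partial>?M)"
    by (intro nn_integral_cong) (auto simp: sum_distrib_left[symmetric] G_sum indicator_def)
  also have "\<dots> = (\<Sum>i\<le>K. \<integral>\<^sup>+s. v * G i s \<partial>?M)"
    by (intro nn_integral_sum) auto
  also have "\<dots> \<le> (\<Sum>i\<le>K. \<integral>\<^sup>+s. G i s * sup_sum H {..<K} s \<partial>?M)"
  proof (rule sum_mono)
    fix i assume "i \<in> {..K}"
    then have i: "{..<i} \<union> {i..<K} = {..<K}" "i \<le> K" by auto
    have "(\<integral>\<^sup>+s. v * G i s \<partial>?M) \<le> (\<integral>\<^sup>+s. G i s * sup_sum H {..<i} s \<partial>?M)"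
      by (intro nn_integral_mono) (auto simp: G_def)
    also have "\<dots> \<le> (\<integral>\<^sup>+s. G i s * sup_sum H {..<K} s \<partial>?M)"
    proof -
      \<comment> \<open>First passage at time \<open>i\<close> is decided by the first
        \<open>i\<close> coordinates.\<close>
      have dep: "G i s = G i t" if "\<And>j. j \<in> {..<i} \<Longrightarrow> s j = t j" for s t
      proof -
        have "sup_sum H {..<j} s = sup_sum H {..<j} t" if "j \<le> i" for j
          by (intro sup_sum_cong \<open>\<And>j. j \<in> {..<i} \<Longrightarrow> s j = t j\<close>) (use that in auto)
        then show ?thesis by (auto simp: G_def)
      qed
      have disj: "{..<i} \<inter> {i..<K} = {}" by auto
      show ?thesis
        by (rule sup_sum_submartingale[of "{..<i}" "{i..<K}" "G i", unfolded i(1),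
              OF finite_lessThan finite_atLeastLessThan disj G_meas[OF i(2)] dep])
    qed
    finally show "(\<integral>\<^sup>+s. v * G i s \<partial>?M) \<le> (\<integral>\<^sup>+s. G i s * sup_sum H {..<K} s \<partial>?M)" .
  qed
  also have "\<dots> = (\<integral>\<^sup>+s. (\<Sum>i\<le>K. G i s) * sup_sum H {..<K} s \<partial>?M)"
    unfolding sum_distrib_right by (intro nn_integral_sum[symmetric]) auto
  also have "\<dots> \<le> (\<integral>\<^sup>+s. sup_sum H {..<K} s \<partial>?M)"
    by (intro nn_integral_mono) (auto simp: G_sum)
  finally show ?thesis .
qed

section \<open>Independent blocks and the weak second moment\<close>

lemma indep_vars_sample:
  assumes "I \<noteq> {}"
  shows "prob_space.indep_vars (\<Pi>\<^sub>M i\<in>I. Q) (\<lambda>_. Q) (\<lambda>i s. s i) I"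
proof -
  interpret M: prob_space "\<Pi>\<^sub>M i\<in>I. Q" by (rule prob_space_sample)
  have "distr (\<Pi>\<^sub>M i\<in>I. Q) (\<Pi>\<^sub>M i\<in>I. Q) (\<lambda>s. \<lambda>i\<in>I. s i) = distr (\<Pi>\<^sub>M i\<in>I. Q) (\<Pi>\<^sub>M i\<in>I. Q) (\<lambda>s. s)"
    by (intro distr_cong refl) (auto simp: space_PiM)
  also have "\<dots> = (\<Pi>\<^sub>M i\<in>I. distr (\<Pi>\<^sub>M i\<in>I. Q) Q (\<lambda>s. s i))"
  proof -
    have "distr (\<Pi>\<^sub>M i\<in>I. Q) Q (\<lambda>s. s i) = Q" if "i \<in> I" for i
      by (rule distr_PiM_component) (use that prob_space_axioms in auto)
    then have "(\<Pi>\<^sub>M i\<in>I. Q) = (\<Pi>\<^sub>M i\<in>I. distr (\<Pi>\<^sub>M i\<in>I. Q) Q (\<lambda>s. s i))"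
      by (intro PiM_cong) simp_all
    then show ?thesis unfolding distr_id2[OF refl] .
  qed
  finally show ?thesis
    using assms by (subst M.indep_vars_iff_distr_eq_PiM') auto
qed

text \<open>The blocks are disjoint and of equal length, so their suprema are independent, each with
  the law of the supremum over one sample of size \<open>n\<close>.\<close>

lemma prob_blocks:
  fixes n k :: nat and u :: ennreal
  defines "B \<equiv> \<lambda>j. {j * n..<(j + 1) * n}"
  assumes n: "n > 0" and k: "k > 0"
  shows "measure (\<Pi>\<^sub>M i\<in>{..<k * n}. Q) {s \<in> space (\<Pi>\<^sub>M i\<in>{..<k * n}. Q). \<forall>j<k. sup_sum H (B j) s \<le> u}
    = measure (\<Pi>\<^sub>M i\<in>{..<n}. Q) {s \<in> space (\<Pi>\<^sub>M i\<in>{..<n}. Q). sup_sum H {..<n} s \<le> u} ^ k"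
proof -
  let ?M = "\<Pi>\<^sub>M i\<in>{..<k * n}. Q"
  interpret M: prob_space ?M by (rule prob_space_sample)
  have B_sub: "B j \<subseteq> {..<k * n}" if "j < k" for j
  proof -
    have "(j + 1) * n \<le> k * n" using that by (intro mult_right_mono) auto
    then show ?thesis by (auto simp: B_def)
  qed
  have B_disj: "disjoint_family_on B {..<k}"
    unfolding disjoint_family_on_def
  proof (intro ballI impI)
    fix i j :: nat assume "i \<noteq> j"
    then have "i + 1 \<le> j \<or> j + 1 \<le> i" by linarith
    then have "(i + 1) * n \<le> j * n \<or> (j + 1) * n \<le> i * n"
      using mult_le_mono1 by blast
    then show "B i \<inter> B j = {}" by (auto simp: B_def)
  qed
  have "M.indep_vars (\<lambda>j. \<Pi>\<^sub>M i\<in>B j. Q) (\<lambda>j s. restrict (\<lambda>i. s i) (B j)) {..<k}"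
  proof (intro M.indep_vars_restrict[OF indep_vars_sample] B_disj)
    have "0 \<in> {..<k * n}" using n k by simp
    then show "{..<k * n} \<noteq> {}" by blast
  qed (use B_sub in auto)
  then have "M.indep_vars (\<lambda>_. borel) (\<lambda>j s. sup_sum H (B j) (restrict (\<lambda>i. s i) (B j))) {..<k}"
    by (rule M.indep_vars_compose2) (auto intro!: sup_sum_measurable simp: B_def)
  moreover have "sup_sum H (B j) (restrict (\<lambda>i. s i) (B j)) = sup_sum H (B j) s" for j s
    by (rule sup_sum_cong) auto
  ultimately have indep: "M.indep_vars (\<lambda>_. borel) (\<lambda>j. sup_sum H (B j)) {..<k}" by simp
  have one: "measure ?M (sup_sum H (B j) -` {..u} \<inter> space ?M)
      = measure (\<Pi>\<^sub>M i\<in>{..<n}. Q) {s \<in> space (\<Pi>\<^sub>M i\<in>{..<n}. Q). sup_sum H {..<n} s \<le> u}"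
    if j: "j < k" for j
  proof -
    \<comment> \<open>Shifting the indices of block \<open>j\<close> to \<open>{..<n}\<close>
      identifies its law with that of a sample of size \<open>n\<close>.\<close>
    let ?t = "\<lambda>s. \<lambda>i\<in>{..<n}. s (j * n + i)"
    have d: "distr ?M (\<Pi>\<^sub>M i\<in>{..<n}. Q) ?t = (\<Pi>\<^sub>M i\<in>{..<n}. Q)"
    proof (rule distr_PiM_reindex)
      have "j * n + i \<in> B j" if "i < n" for i using that by (auto simp: B_def)
      then show "(\<lambda>i. j * n + i) \<in> {..<n} \<rightarrow> {..<k * n}" using B_sub[OF j] by blast
    qed (auto simp: prob_space_axioms inj_on_def)
    have t: "?t \<in> measurable ?M (\<Pi>\<^sub>M i\<in>{..<n}. Q)"
    proof (rule measurable_restrict)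
      fix i assume "i \<in> {..<n}"
      then have "j * n + i \<in> B j" by (auto simp: B_def)
      then show "(\<lambda>s. s (j * n + i)) \<in> measurable ?M Q"
        using B_sub[OF j] by (intro measurable_component_singleton) auto
    qed
    have [measurable]: "sup_sum H {..<n} \<in> borel_measurable (\<Pi>\<^sub>M i\<in>{..<n}. Q)"
      by (rule sup_sum_measurable) auto
    have shift: "sup_sum H {..<n} (?t s) = sup_sum H (B j) s" for s
    proof -
      have "(\<Sum>i<n. h (?t s i)) = (\<Sum>i\<in>B j. h (s i))" for h :: "'a \<Rightarrow> real"
      proof -
        have "(\<Sum>i<n. h (?t s i)) = (\<Sum>i<n. h (s (j * n + i)))" by simp
        also have "\<dots> = (\<Sum>i\<in>B j. h (s i))"
          by (rule sum.reindex_bij_witness[of _ "\<lambda>i. i - j * n" "\<lambda>i. j * n + i"]) (auto simp: B_def)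
        finally show ?thesis .
      qed
      then show ?thesis unfolding sup_sum_def by presburger
    qed
    have "measure (distr ?M (\<Pi>\<^sub>M i\<in>{..<n}. Q) ?t) {s \<in> space (\<Pi>\<^sub>M i\<in>{..<n}. Q). sup_sum H {..<n} s \<le> u}
      = measure ?M (?t -` {s \<in> space (\<Pi>\<^sub>M i\<in>{..<n}. Q). sup_sum H {..<n} s \<le> u} \<inter> space ?M)"
      by (rule measure_distr[OF t]) measurable
    also have "?t -` {s \<in> space (\<Pi>\<^sub>M i\<in>{..<n}. Q). sup_sum H {..<n} s \<le> u} \<inter> space ?M
        = sup_sum H (B j) -` {..u} \<inter> space ?M"
      using measurable_space[OF t] by (auto simp: shift)
    finally show ?thesis unfolding d by simp
  qed
  have "{s \<in> space ?M. \<forall>j<k. sup_sum H (B j) s \<le> u} = (\<Inter>j\<in>{..<k}. sup_sum H (B j) -` {..u} \<inter> space ?M)"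
    using k by auto
  also have "measure ?M \<dots> = (\<Prod>j\<in>{..<k}. measure ?M (sup_sum H (B j) -` {..u} \<inter> space ?M))"
    using k by (intro M.indep_varsD_finite[OF indep]) auto
  also have "\<dots> = measure (\<Pi>\<^sub>M i\<in>{..<n}. Q) {s \<in> space (\<Pi>\<^sub>M i\<in>{..<n}. Q). sup_sum H {..<n} s \<le> u} ^ k"
    using one by simp
  finally show ?thesis .
qed

text \<open>If some block exceeds \<open>2 * v\<close>, one of the initial segments ending at its
  two endpoints exceeds \<open>v\<close>, which the maximal inequality at sample size
  \<open>k * n\<close> controls. By independence, the probability that no block exceeds
  \<open>2 * v\<close> is a \<open>k\<close>-th power.\<close>

lemma block_maximal_inequality:
  fixes n k :: nat and v A :: real
  assumes n: "n > 0" and k: "k > 0" and v: "v \<ge> 0" and A: "A \<ge> 0"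
    and bound: "(\<integral>\<^sup>+s. sup_sum H {..<k * n} s \<partial>(\<Pi>\<^sub>M i\<in>{..<k * n}. Q)) \<le> ennreal A"
  shows "v * (1 - measure (\<Pi>\<^sub>M i\<in>{..<n}. Q)
       {s \<in> space (\<Pi>\<^sub>M i\<in>{..<n}. Q). sup_sum H {..<n} s \<le> ennreal (2 * v)} ^ k) \<le> A"
proof -
  let ?M = "\<Pi>\<^sub>M i\<in>{..<k * n}. Q"
  let ?B = "\<lambda>j. {j * n..<(j + 1) * n}"
  let ?E = "{s \<in> space ?M. \<forall>j<k. sup_sum H (?B j) s \<le> ennreal (2 * v)}"
  let ?F = "{s \<in> space ?M. \<exists>i\<le>k * n. ennreal v < sup_sum H {..<i} s}"
  interpret M: prob_space ?M by (rule prob_space_sample)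
  have le: "(j + 1) * n \<le> k * n" if "j < k" for j
    using that by (intro mult_right_mono) auto
  have [measurable]: "sup_sum H {..<i} \<in> borel_measurable ?M" if "i \<le> k * n" for i
    using that by (intro sup_sum_measurable) auto
  have [measurable]: "sup_sum H (?B j) \<in> borel_measurable ?M" if "j < k" for j
    using le[OF that] by (intro sup_sum_measurable) auto
  have "?E = {s \<in> space ?M. \<forall>j\<in>{..<k}. sup_sum H (?B j) s \<le> ennreal (2 * v)}" by auto
  also have "\<dots> \<in> sets ?M" by (measurable; auto)
  finally have E: "?E \<in> sets ?M" .
  have "?F = {s \<in> space ?M. \<exists>i\<in>{..k * n}. ennreal v < sup_sum H {..<i} s}" by auto
  also have "\<dots> \<in> sets ?M" by (measurable; auto)
  finally have F: "?F \<in> sets ?M" .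
  have sub: "space ?M - ?E \<subseteq> ?F"
  proof
    fix s assume s: "s \<in> space ?M - ?E"
    then obtain j where j: "j < k" "\<not> sup_sum H (?B j) s \<le> ennreal (2 * v)" by blast
    have "ennreal (2 * v) < sup_sum H (?B j) s" using j by simp
    also have "?B j = {..<(j + 1) * n} - {..<j * n}" by auto
    also have "sup_sum H ({..<(j + 1) * n} - {..<j * n}) s \<le> sup_sum H {..<(j + 1) * n} s + sup_sum H {..<j * n} s"
      by (rule sup_sum_le_add) auto
    finally have "\<not> (sup_sum H {..<(j + 1) * n} s \<le> ennreal v \<and> sup_sum H {..<j * n} s \<le> ennreal v)"
      using v by (metis add_mono ennreal_plus mult_2 not_less)
    moreover have "j * n \<le> k * n" using j(1) by simp
    moreover note le[OF j(1)]
    ultimately show "s \<in> ?F" using s unfolding not_le[symmetric] by blast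
  qed
  have "ennreal (v * measure ?M ?F) = ennreal v * emeasure ?M ?F"
    using v by (simp add: M.emeasure_eq_measure ennreal_mult)
  also have "\<dots> \<le> ennreal A" using maximal_inequality[of "ennreal v" "k * n"] bound by (rule order_trans)
  finally have "v * measure ?M ?F \<le> A" using A by simp
  moreover have "1 - measure ?M ?E \<le> measure ?M ?F"
    using M.finite_measure_mono[OF sub F] M.prob_compl[OF E] by simp
  ultimately have "v * (1 - measure ?M ?E) \<le> A"
    using v by (meson mult_left_mono order_trans)
  then show ?thesis unfolding prob_blocks[OF n k] .
qed

text \<open>A single sample size would only give a Markov bound \<open>O(1/u)\<close>, too weak for fast rates.
  Here \<open>k \<approx> 1/q\<close> independent copies of the sample, where \<open>q\<close> is the probability to be bounded,
  make a large block likely; by the maximal inequality this forces the mean at sample size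
  \<open>k n\<close> to be large, and \<open>q = O(1/u\<^sup>2)\<close> follows.\<close>

lemma weak_moment_bound:
  fixes n :: nat and A u :: real
  assumes n: "n > 0" and A: "A \<ge> 0" and u: "u > 0"
    and bound: "\<And>m. m > 0 \<Longrightarrow>
      (\<integral>\<^sup>+s. sup_sum H {..<m} s \<partial>(\<Pi>\<^sub>M i\<in>{..<m}. Q)) \<le> ennreal (A * sqrt m)"
  shows "measure (\<Pi>\<^sub>M i\<in>{..<n}. Q) {s \<in> space (\<Pi>\<^sub>M i\<in>{..<n}. Q). ennreal u < sup_sum H {..<n} s}
    \<le> 32 * A\<^sup>2 * n / u\<^sup>2"
proof -
  let ?M = "\<Pi>\<^sub>M i\<in>{..<n}. Q"
  interpret M: prob_space ?M by (rule prob_space_sample)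
  let ?E = "{s \<in> space ?M. sup_sum H {..<n} s \<le> ennreal u}"
  have [measurable]: "sup_sum H {..<n} \<in> borel_measurable ?M" by (intro sup_sum_measurable) auto
  define q where "q = measure ?M {s \<in> space ?M. ennreal u < sup_sum H {..<n} s}"
  have "{s \<in> space ?M. ennreal u < sup_sum H {..<n} s} = space ?M - ?E" by auto
  then have q: "measure ?M ?E = 1 - q" unfolding q_def by (simp add: M.prob_compl)
  have q01: "0 \<le> q" "q \<le> 1" unfolding q_def by auto
  show ?thesis
  proof (cases "q = 0")
    case True then show ?thesis unfolding q_def[symmetric] by simp
  next
    case False
    with q01 have "q > 0" by simp
    \<comment> \<open>The smallest integer with \<open>k * q \<ge> 1\<close>: many enough blocks for
      a large one to be likely, yet at most \<open>2 / q\<close> of them.\<close>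
    define k where "k = nat \<lceil>1 / q\<rceil>"
    have k1: "1 / q \<le> real k" unfolding k_def by linarith
    then have "real k > 0" using \<open>q > 0\<close> by (meson divide_pos_pos less_le_trans zero_less_one)
    then have k0: "k > 0" by simp
    have "real k = real_of_int \<lceil>1 / q\<rceil>" unfolding k_def using \<open>q > 0\<close> by simp
    then have "real k \<le> 1 / q + 1" using of_int_ceiling_le_add_one[of "1 / q"] by linarith
    also have "\<dots> \<le> 2 / q" using q01 \<open>q > 0\<close> by (simp add: field_simps)
    finally have k2: "real k \<le> 2 / q" .
    have kq: "real k * q \<ge> 1" using k1 \<open>q > 0\<close> by (simp add: field_simps)
    \<comment> \<open>Bernoulli's inequality gives \<open>(1 + q) ^ k \<ge> 2\<close>; since
      \<open>(1 - q) ^ k * (1 + q) ^ k \<le> 1\<close>, all blocks are small with probability at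
      most one half.\<close>
    have "(1 - q) ^ k * 2 \<le> (1 - q) ^ k * (1 + q) ^ k"
    proof (rule mult_left_mono)
      have "1 + real k * q \<le> (1 + q) ^ k" using q01 by (intro Bernoulli_inequality) auto
      then show "2 \<le> (1 + q) ^ k" using kq by simp
    qed (use q01 in auto)
    also have "\<dots> = (1 - q\<^sup>2) ^ k" by (simp add: power_mult_distrib[symmetric] power2_eq_square algebra_simps)
    also have "\<dots> \<le> 1" using q01 by (intro power_le_one) (auto simp: power_le_one)
    finally have half: "1 - (1 - q) ^ k \<ge> 1 / 2" by simp
    have "(u / 2) * (1 - (1 - q) ^ k) \<le> A * sqrt (k * n)"
      using block_maximal_inequality[of n k "u / 2" "A * sqrt (k * n)"] bound[of "k * n"] n k0 A u q
      by simp
    then have "(u / 2) * (1 / 2) \<le> A * sqrt (k * n)"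
      using mult_left_mono[OF half, of "u / 2"] u by linarith
    \<comment> \<open>The mean grows only like the square root of \<open>k\<close>, which is of
      order \<open>1 / q\<close>; squaring therefore yields a bound on \<open>q\<close> quadratic in
      \<open>1 / u\<close>.\<close>
    then have "(u / 4)\<^sup>2 \<le> (A * sqrt (k * n))\<^sup>2"
      using u by (intro power_mono) auto
    also have "\<dots> = A\<^sup>2 * n * k" by (simp add: power_mult_distrib)
    also have "\<dots> \<le> A\<^sup>2 * n * (2 / q)" by (intro mult_left_mono k2) auto
    finally have "q * u\<^sup>2 \<le> 32 * A\<^sup>2 * n" using \<open>q > 0\<close> by (simp add: field_simps power2_eq_square)
    then show ?thesis unfolding q_def[symmetric] using u by (simp add: field_simps)
  qed
qed

end

text \<open>The supremum depends on the sample through finitely many coordinates, in which it is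
  lower semicontinuous; this makes it measurable even for an uncountable class.\<close>

lemma sup_sum_measurable_finite_dimensional:
  fixes e :: "'k::countable \<Rightarrow> 'a \<Rightarrow> real"
  assumes F: "finite F" and e: "\<And>k. k \<in> F \<Longrightarrow> e k \<in> borel_measurable Q"
    and H: "\<And>h. h \<in> H \<Longrightarrow> \<exists>c. \<forall>x\<in>space Q. h x = (\<Sum>k\<in>F. c k * e k x)"
    and J: "finite J" "I \<subseteq> J"
  shows "sup_sum H I \<in> borel_measurable (\<Pi>\<^sub>M i\<in>J. Q)"
proof -
  obtain c where c: "\<And>h x. h \<in> H \<Longrightarrow> x \<in> space Q \<Longrightarrow> h x = (\<Sum>k\<in>F. c h k * e k x)"
    using H by metis
  define \<Phi> :: "('k \<Rightarrow> real) \<Rightarrow> ennreal" where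
    "\<Phi> v = (\<Squnion>h\<in>H. ennreal \<bar>\<Sum>k\<in>F. c h k * v k\<bar>)" for v
  \<comment> \<open>These are the finitely many sums through which the supremum sees the
    sample.\<close>
  define U where "U s k = (if k \<in> F then \<Sum>i\<in>I. e k (s i) else 0)" for s :: "nat \<Rightarrow> 'a" and k
  have "\<Phi> \<in> borel_measurable borel"
  proof (rule borel_measurableI_greater)
    fix t
    have "open {v. t < ennreal \<bar>\<Sum>k\<in>F. c h k * v k\<bar>}" for h
      by (intro open_Collect_less continuous_on_const continuous_on_ennreal continuous_on_rabs
          continuous_on_sum continuous_on_mult continuous_on_product_coordinates)
    then have "open (\<Union>h\<in>H. {v. t < ennreal \<bar>\<Sum>k\<in>F. c h k * v k\<bar>})" by blast
    also have "(\<Union>h\<in>H. {v. t < ennreal \<bar>\<Sum>k\<in>F. c h k * v k\<bar>}) = {v \<in> space borel. t < \<Phi> v}"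
      by (auto simp: \<Phi>_def less_SUP_iff)
    finally show "{v \<in> space borel. t < \<Phi> v} \<in> sets borel" by (rule borel_open)
  qed
  \<comment> \<open>Countability of \<open>'k\<close> makes coordinatewise measurability suffice for
    the Borel sets of the function space.\<close>
  moreover have "U \<in> borel_measurable (\<Pi>\<^sub>M i\<in>J. Q)"
  proof (rule measurable_coordinatewise_then_product)
    fix k
    have "(\<lambda>s. e k (s i)) \<in> borel_measurable (\<Pi>\<^sub>M i\<in>J. Q)" if "i \<in> I" "k \<in> F" for i
      using that J e by (intro measurable_compose[OF measurable_component_singleton]) auto
    then show "(\<lambda>s. U s k) \<in> borel_measurable (\<Pi>\<^sub>M i\<in>J. Q)"
      unfolding U_def by (cases "k \<in> F") auto
  qed
  ultimately have "(\<lambda>s. \<Phi> (U s)) \<in> borel_measurable (\<Pi>\<^sub>M i\<in>J. Q)"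
    by (rule measurable_compose[rotated])
  moreover have "\<Phi> (U s) = sup_sum H I s" if s: "s \<in> space (\<Pi>\<^sub>M i\<in>J. Q)" for s
  proof -
    have "(\<Sum>k\<in>F. c h k * U s k) = (\<Sum>i\<in>I. h (s i))" if "h \<in> H" for h
    proof -
      have "(\<Sum>k\<in>F. c h k * U s k) = (\<Sum>k\<in>F. \<Sum>i\<in>I. c h k * e k (s i))"
        by (auto simp: U_def sum_distrib_left intro!: sum.cong)
      also have "\<dots> = (\<Sum>i\<in>I. h (s i))"
        using s J by (subst sum.swap) (auto intro!: sum.cong c[OF that, symmetric] simp: space_PiM)
      finally show ?thesis .
    qed
    then show ?thesis unfolding \<Phi>_def sup_sum_def by (intro SUP_cong) auto
  qed
  ultimately show ?thesis by (rule measurable_cong[THEN iffD1, rotated])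
qed

section \<open>Labelled measures\<close>

text \<open>A general \<open>\<nu>\<close> is kept because the setting occurs twice, on the space of
  \<open>X\<close> and on that of the observations \<open>Z\<close>, with common label
  probabilities.\<close>

locale labelled_measure = sigma_finite_measure \<nu> for \<nu> :: "'a measure" +
  fixes M :: nat and p :: "nat \<Rightarrow> real"
  assumes p_nonneg: "y \<le> M \<Longrightarrow> 0 \<le> p y" and p_sum: "(\<Sum>y\<le>M. p y) = 1"
begin

abbreviation \<nu>Y :: "('a \<times> nat) measure" where
  "\<nu>Y \<equiv> \<nu> \<Otimes>\<^sub>M label_law M p"

lemma sets_label_law [measurable_cong]: "sets (label_law M p) = sets (count_space {..M})"
  by (simp add: label_law_def sets_point_measure)

lemma space_label_law [simp]: "space (label_law M p) = {..M}"
  by (simp add: label_law_def space_point_measure)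

lemma finite_label_law: "finite_measure (label_law M p)"
  by (rule finite_measureI)
    (simp add: label_law_def space_point_measure emeasure_point_measure_finite p_nonneg sum_ennreal)

sublocale pair_sigma_finite \<nu> "label_law M p"
  using finite_label_law by (intro pair_sigma_finite.intro sigma_finite_measure_axioms finite_measure.axioms(1))

text \<open>There are finitely many labels, so measurability can be checked slice by slice.\<close>

lemma measurable_labelled:
  assumes "\<And>y. y \<le> M \<Longrightarrow> (\<lambda>x. h (x, y)) \<in> measurable \<nu> N"
  shows "h \<in> measurable \<nu>Y N"
proof -
  have "h \<in> measurable (\<nu> \<Otimes>\<^sub>M count_space {..M}) N"
    by (rule measurable_compose_countable'[where f="\<lambda>y w. h (fst w, y)" and g=snd and I="{..M}", simplified])
      (auto intro!: measurable_compose[OF measurable_fst] assms)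
  then show ?thesis by (simp cong: measurable_cong_sets add: sets_label_law sets_pair_measure_cong)
qed

lemma nn_integral_labelled:
  assumes "\<And>y. y \<le> M \<Longrightarrow> (\<lambda>x. h (x, y)) \<in> borel_measurable \<nu>"
  shows "(\<integral>\<^sup>+w. h w \<partial>\<nu>Y) = (\<Sum>y\<le>M. ennreal (p y) * (\<integral>\<^sup>+x. h (x, y) \<partial>\<nu>))"
proof -
  have "(\<integral>\<^sup>+w. h w \<partial>\<nu>Y) = (\<integral>\<^sup>+y. \<integral>\<^sup>+x. h (x, y) \<partial>\<nu> \<partial>label_law M p)"
    by (intro nn_integral_snd[symmetric] measurable_labelled assms)
  then show ?thesis by (simp add: label_law_def nn_integral_point_measure_finite)
qed

text \<open>By Tonelli the exceptional set is null because each of its slices is.\<close>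

lemma AE_labelled:
  assumes [measurable]: "\<And>y. y \<le> M \<Longrightarrow> Measurable.pred \<nu> (\<lambda>x. Q (x, y))"
    and "\<And>y. y \<le> M \<Longrightarrow> AE x in \<nu>. Q (x, y)"
  shows "AE w in \<nu>Y. Q w"
proof -
  have [measurable]: "Measurable.pred \<nu>Y Q" by (intro measurable_labelled) auto
  have "(\<integral>\<^sup>+w. indicator {w. \<not> Q w} w \<partial>\<nu>Y)
      = (\<Sum>y\<le>M. ennreal (p y) * (\<integral>\<^sup>+x. indicator {w. \<not> Q w} (x, y) \<partial>\<nu>))"
  proof (rule nn_integral_labelled)
    fix y assume [simp]: "y \<le> M"
    have "(\<lambda>x. if Q (x, y) then 0 else (1::ennreal)) \<in> borel_measurable \<nu>" by (measurable; simp)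
    also have "(\<lambda>x. if Q (x, y) then 0 else (1::ennreal)) = (\<lambda>x. indicator {w. \<not> Q w} (x, y))"
      by (auto simp: indicator_def)
    finally show "(\<lambda>x. indicator {w. \<not> Q w} (x, y) :: ennreal) \<in> borel_measurable \<nu>" .
  qed
  also have "\<dots> = (\<Sum>y\<le>M. 0)"
  proof (rule sum.cong[OF refl])
    fix y assume "y \<in> {..M}"
    then have "(\<integral>\<^sup>+x. indicator {w. \<not> Q w} (x, y) \<partial>\<nu>) = (\<integral>\<^sup>+x. 0 \<partial>\<nu>)"
      using assms(2)[of y] by (intro nn_integral_cong_AE) (auto elim!: AE_mp simp: indicator_def)
    then show "ennreal (p y) * (\<integral>\<^sup>+x. indicator {w. \<not> Q w} (x, y) \<partial>\<nu>) = 0" by simp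
  qed
  finally show ?thesis by (subst AE_iff_nn_integral) (auto)
qed

lemma integral_labelled:
  fixes h :: "'a \<times> nat \<Rightarrow> real"
  assumes "\<And>y. y \<le> M \<Longrightarrow> integrable \<nu> (\<lambda>x. h (x, y))"
  shows "integrable \<nu>Y h" "(\<integral>w. h w \<partial>\<nu>Y) = (\<Sum>y\<le>M. p y * (\<integral>x. h (x, y) \<partial>\<nu>))"
proof -
  have [measurable]: "h \<in> borel_measurable \<nu>Y"
    using assms by (intro measurable_labelled) auto
  have "(\<integral>\<^sup>+w. ennreal (norm (h w)) \<partial>\<nu>Y) = (\<Sum>y\<le>M. ennreal (p y) * (\<integral>\<^sup>+x. ennreal (norm (h (x, y))) \<partial>\<nu>))"
    using assms by (intro nn_integral_labelled) auto
  also have "\<dots> < \<infinity>"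
    using assms by (auto simp: integrable_iff_bounded ennreal_mult_less_top)
  finally show int: "integrable \<nu>Y h" by (simp add: integrable_iff_bounded)
  have "(\<integral>w. h w \<partial>\<nu>Y) = (\<integral>y. \<integral>x. h (x, y) \<partial>\<nu> \<partial>label_law M p)"
    using integral_snd[of "\<lambda>x y. h (x, y)"] int by simp
  also have "\<dots> = (\<Sum>y\<le>M. p y * (\<integral>x. h (x, y) \<partial>\<nu>))"
    unfolding label_law_def by (subst lebesgue_integral_point_measure_finite) (auto simp: p_nonneg)
  finally show "(\<integral>w. h w \<partial>\<nu>Y) = (\<Sum>y\<le>M. p y * (\<integral>x. h (x, y) \<partial>\<nu>))" .
qed

section \<open>Laws of labelled pairs\<close>

lemma space_joint_law [simp]: "space (joint_law \<nu> M p f) = space \<nu> \<times> {..M}"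
  by (simp add: joint_law_def space_pair_measure)

lemma sets_joint_law [measurable_cong]: "sets (joint_law \<nu> M p f) = sets \<nu>Y"
  by (simp add: joint_law_def)

context
  fixes f :: "nat \<Rightarrow> 'a \<Rightarrow> real"
  assumes f: "\<And>y. y \<le> M \<Longrightarrow> prob_density \<nu> (f y)"
begin

lemma density_facts:
  assumes "y \<le> M"
  shows "f y \<in> borel_measurable \<nu>" "integrable \<nu> (f y)" "(\<integral>x. f y x \<partial>\<nu>) = 1" "AE x in \<nu>. 0 \<le> f y x"
  using f[OF assms] unfolding prob_density_def by (auto simp: has_bochner_integral_iff)

text \<open>Means under the law of a pair become label averages of integrals against the conditional
  densities, to which the inner product calculus applies.\<close>

lemma integral_joint_law:
  fixes h :: "'a \<times> nat \<Rightarrow> real"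
  assumes h: "\<And>y. y \<le> M \<Longrightarrow> (\<lambda>x. h (x, y)) \<in> borel_measurable \<nu>"
    and int: "\<And>y. y \<le> M \<Longrightarrow> integrable \<nu> (\<lambda>x. f y x * h (x, y))"
  shows "integrable (joint_law \<nu> M p f) h"
    and "(\<integral>w. h w \<partial>joint_law \<nu> M p f) = (\<Sum>y\<le>M. p y * (\<integral>x. f y x * h (x, y) \<partial>\<nu>))"
proof -
  have law: "joint_law \<nu> M p f = density \<nu>Y (\<lambda>w. ennreal (f (snd w) (fst w)))"
    by (simp add: joint_law_def case_prod_beta')
  have f_meas: "(\<lambda>w. f (snd w) (fst w)) \<in> borel_measurable \<nu>Y"
    by (intro measurable_labelled) (auto simp: density_facts)
  \<comment> \<open>\<open>joint_law\<close> applies \<open>ennreal\<close> to the density, which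
    cuts off negative values; nonnegativity almost everywhere makes this harmless.\<close>
  have f_pos: "AE w in \<nu>Y. 0 \<le> f (snd w) (fst w)"
  proof (rule AE_labelled)
    fix y assume y: "y \<le> M"
    note [measurable] = density_facts(1)[OF y]
    show "Measurable.pred \<nu> (\<lambda>x. 0 \<le> f (snd (x, y)) (fst (x, y)))" by simp
    show "AE x in \<nu>. 0 \<le> f (snd (x, y)) (fst (x, y))" using density_facts(4)[OF y] by simp
  qed
  have h_meas: "h \<in> borel_measurable \<nu>Y" by (intro measurable_labelled h)
  have "integrable \<nu>Y (\<lambda>w. f (snd w) (fst w) *\<^sub>R h w)"
    using int by (intro integral_labelled) auto
  then show "integrable (joint_law \<nu> M p f) h"
    unfolding law by (subst integrable_density[OF h_meas f_meas f_pos])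
  have "(\<integral>w. h w \<partial>joint_law \<nu> M p f) = (\<integral>w. f (snd w) (fst w) *\<^sub>R h w \<partial>\<nu>Y)"
    unfolding law by (rule integral_density[OF h_meas f_meas f_pos])
  also have "\<dots> = (\<Sum>y\<le>M. p y * (\<integral>x. f y x * h (x, y) \<partial>\<nu>))"
    using int by (subst integral_labelled) auto
  finally show "(\<integral>w. h w \<partial>joint_law \<nu> M p f) = (\<Sum>y\<le>M. p y * (\<integral>x. f y x * h (x, y) \<partial>\<nu>))" .
qed

lemma prob_space_joint_law: "prob_space (joint_law \<nu> M p f)"
proof (rule prob_spaceI)
  let ?f = "\<lambda>w. ennreal (f (snd w) (fst w))"
  have f_meas: "(\<lambda>x. ennreal (f y x)) \<in> borel_measurable \<nu>" if "y \<le> M" for y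
    using density_facts(1)[OF that] by (rule measurable_compose[OF _ measurable_ennreal])
  have "?f \<in> borel_measurable \<nu>Y"
    by (intro measurable_labelled) (simp add: f_meas)
  then have "emeasure (joint_law \<nu> M p f) (space (joint_law \<nu> M p f)) = (\<integral>\<^sup>+w. ?f w \<partial>\<nu>Y)"
    unfolding joint_law_def case_prod_beta'
    by (subst emeasure_density) (auto intro!: nn_integral_cong split: split_indicator)
  also have "\<dots> = (\<Sum>y\<le>M. ennreal (p y) * (\<integral>\<^sup>+x. ennreal (f y x) \<partial>\<nu>))"
    by (subst nn_integral_labelled) (simp_all add: f_meas)
  also have "\<dots> = (\<Sum>y\<le>M. ennreal (p y))"
    by (intro sum.cong refl) (simp add: nn_integral_eq_integral density_facts)
  also have "\<dots> = 1" using p_nonneg p_sum by (subst sum_ennreal) auto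
  finally show "emeasure (joint_law \<nu> M p f) (space (joint_law \<nu> M p f)) = 1" .
qed

end

end

section \<open>Truncation of orthonormal expansions\<close>

lemma L2_mult_integrable:
  assumes "f \<in> L2 M" "g \<in> L2 M"
  shows "integrable M (\<lambda>x. f x * g x)"
proof (rule Bochner_Integration.integrable_bound)
  show "integrable M (\<lambda>x. (f x)\<^sup>2 + (g x)\<^sup>2)" using assms by (auto simp: L2_def)
  show "(\<lambda>x. f x * g x) \<in> borel_measurable M" using assms by (auto simp: L2_def)
  have "\<bar>a * b\<bar> \<le> a\<^sup>2 + b\<^sup>2" for a b :: real
    using sum_squares_bound[of "\<bar>a\<bar>" "\<bar>b\<bar>"] mult_nonneg_nonneg[OF abs_ge_zero abs_ge_zero, of a b]
    unfolding abs_mult power2_abs by linarith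
  then show "AE x in M. norm (f x * g x) \<le> norm ((f x)\<^sup>2 + (g x)\<^sup>2)" by simp
qed

lemma L2_lincomb:
  assumes "f \<in> L2 M" "g \<in> L2 M"
  shows "(\<lambda>x. a * f x + b * g x) \<in> L2 M"
proof -
  have "(\<lambda>x. (a * f x + b * g x)\<^sup>2)
      = (\<lambda>x. a\<^sup>2 * (f x)\<^sup>2 + b\<^sup>2 * (g x)\<^sup>2 + (2 * a * b) * (f x * g x))"
    by (auto simp: power2_eq_square algebra_simps)
  then show ?thesis using assms L2_mult_integrable[OF assms] by (auto simp: L2_def)
qed

lemma L2_diff: "f \<in> L2 M \<Longrightarrow> g \<in> L2 M \<Longrightarrow> (\<lambda>x. f x - g x) \<in> L2 M"
  using L2_lincomb[of f M g 1 "-1"] by simp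

lemma L2_sum:
  assumes "\<And>k. k \<in> F \<Longrightarrow> f k \<in> L2 M"
  shows "(\<lambda>x. \<Sum>k\<in>F. a k * f k x) \<in> L2 M"
  using assms
proof (induction F rule: infinite_finite_induct)
  case (insert k F)
  have "(\<lambda>x. a k * f k x + 1 * (\<Sum>k\<in>F. a k * f k x)) \<in> L2 M"
    using insert by (intro L2_lincomb) auto
  then show ?case using insert by simp
qed (auto simp: L2_def)

lemma L2_norm_nonneg: "0 \<le> L2_norm M f"
  by (simp add: L2_norm_def)

lemma L2_norm_power2: "(L2_norm M f)\<^sup>2 = (\<integral>x. (f x)\<^sup>2 \<partial>M)"
  by (simp add: L2_norm_def)

lemma L2_Cauchy_Schwarz:
  assumes f: "f \<in> L2 M" and g: "g \<in> L2 M"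
  shows "\<bar>L2_inner M f g\<bar> \<le> L2_norm M f * L2_norm M g"
proof -
  let ?a = "\<integral>x. (f x)\<^sup>2 \<partial>M" and ?b = "\<integral>x. f x * g x \<partial>M" and ?c = "\<integral>x. (g x)\<^sup>2 \<partial>M"
  have i: "integrable M (\<lambda>x. (f x)\<^sup>2)" "integrable M (\<lambda>x. (g x)\<^sup>2)" "integrable M (\<lambda>x. f x * g x)"
    using f g L2_mult_integrable by (auto simp: L2_def)
  \<comment> \<open>The squared norm of \<open>s * f - t * g\<close> is a nonnegative quadratic form
    in \<open>s\<close> and \<open>t\<close>; suitable choices of the two give the
    inequality.\<close>
  have quad: "0 \<le> s\<^sup>2 * ?a - 2 * s * t * ?b + t\<^sup>2 * ?c" for s t
  proof -
    have "0 \<le> (\<integral>x. (s * f x - t * g x)\<^sup>2 \<partial>M)" by simp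
    also have "(\<lambda>x. (s * f x - t * g x)\<^sup>2) = (\<lambda>x. s\<^sup>2 * (f x)\<^sup>2 - 2 * s * t * (f x * g x) + t\<^sup>2 * (g x)\<^sup>2)"
      by (auto simp: power2_eq_square algebra_simps)
    also have "(\<integral>x. \<dots> x \<partial>M) = s\<^sup>2 * ?a - 2 * s * t * ?b + t\<^sup>2 * ?c" using i by simp
    finally show ?thesis .
  qed
  have nn: "0 \<le> ?a" "0 \<le> ?c" by simp_all
  have "?b\<^sup>2 \<le> ?a * ?c"
  proof (cases "?c = 0")
    case True
    have "?b = 0"
    proof (rule ccontr)
      assume "?b \<noteq> 0"
      \<comment> \<open>For \<open>s = 1\<close> and \<open>t = (?a + 1) / (2 * ?b)\<close> the
        quadratic form would equal \<open>-1\<close>.\<close>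
      then show False
        using quad[of 1 "(?a + 1) / (2 * ?b)"] nn True by (simp add: field_simps)
    qed
    then show ?thesis using nn by simp
  next
    case False
    then have "?c > 0" using nn(2) by (intro le_neq_trans) auto
    \<comment> \<open>The choice \<open>s = ?c\<close>, \<open>t = ?b\<close> produces the
      determinant times \<open>?c\<close>, and this positive factor cancels.\<close>
    have "0 \<le> ?c * (?a * ?c - ?b\<^sup>2)"
      using quad[of ?c ?b] by (simp add: power2_eq_square algebra_simps)
    then show ?thesis using \<open>?c > 0\<close> by (simp add: zero_le_mult_iff)
  qed
  then have "sqrt (?b\<^sup>2) \<le> sqrt (?a * ?c)" by (rule real_sqrt_le_mono)
  then show ?thesis by (simp add: L2_inner_def L2_norm_def real_sqrt_mult)
qed

lemma L2_inner_diff_left: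
  "f \<in> L2 M \<Longrightarrow> g \<in> L2 M \<Longrightarrow> h \<in> L2 M \<Longrightarrow>
    L2_inner M (\<lambda>x. f x - g x) h = L2_inner M f h - L2_inner M g h"
  unfolding L2_inner_def by (simp add: left_diff_distrib L2_mult_integrable)

lemma L2_inner_sum_left:
  assumes "\<And>k. k \<in> F \<Longrightarrow> f k \<in> L2 M" "h \<in> L2 M"
  shows "L2_inner M (\<lambda>x. \<Sum>k\<in>F. a k * f k x) h = (\<Sum>k\<in>F. a k * L2_inner M (f k) h)"
proof -
  have "L2_inner M (\<lambda>x. \<Sum>k\<in>F. a k * f k x) h = (\<integral>x. (\<Sum>k\<in>F. a k * (f k x * h x)) \<partial>M)"
    by (simp add: L2_inner_def sum_distrib_right mult.assoc)
  also have "\<dots> = (\<Sum>k\<in>F. a k * L2_inner M (f k) h)"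
    using assms L2_mult_integrable by (subst Bochner_Integration.integral_sum) (auto simp: L2_inner_def)
  finally show ?thesis .
qed

lemma L2_inner_commute: "L2_inner M f g = L2_inner M g f"
  by (simp add: L2_inner_def mult.commute)

lemma L2_norm_orthonormal_sum:
  assumes "finite F" and \<phi>: "\<And>k. k \<in> F \<Longrightarrow> \<phi> k \<in> L2 M"
    and orth: "\<And>j k. j \<in> F \<Longrightarrow> k \<in> F \<Longrightarrow> L2_inner M (\<phi> j) (\<phi> k) = (if j = k then 1 else 0)"
  shows "(L2_norm M (\<lambda>x. \<Sum>k\<in>F. a k * \<phi> k x))\<^sup>2 = (\<Sum>k\<in>F. (a k)\<^sup>2)"
proof -
  let ?S = "\<lambda>x. \<Sum>k\<in>F. a k * \<phi> k x"
  have S: "?S \<in> L2 M" using \<phi> by (rule L2_sum)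
  have "(L2_norm M ?S)\<^sup>2 = L2_inner M ?S ?S"
    unfolding L2_norm_power2 by (simp add: L2_inner_def power2_eq_square)
  also have "\<dots> = (\<Sum>k\<in>F. a k * L2_inner M ?S (\<phi> k))"
    using L2_inner_sum_left[of F \<phi> M ?S a] \<phi> S by (simp add: L2_inner_commute)
  also have "\<dots> = (\<Sum>k\<in>F. a k * (\<Sum>j\<in>F. a j * (if j = k then 1 else 0)))"
    using \<phi> orth by (intro sum.cong refl arg_cong2[where f="(*)"]) (simp add: L2_inner_sum_left)
  also have "\<dots> = (\<Sum>k\<in>F. (a k)\<^sup>2)"
    using assms(1) by (intro sum.cong refl) (simp add: power2_eq_square if_distrib sum.delta cong: if_cong)
  finally show ?thesis .
qed

text \<open>By Cauchy-Schwarz the inner product with \<open>h\<close> is continuous in the norm, so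
  it passes through the expansion of \<open>f\<close>.\<close>

lemma L2_inner_expansion:
  assumes f: "f \<in> L2 M" and h: "h \<in> L2 M" and \<phi>: "\<And>k. k \<ge> 1 \<Longrightarrow> \<phi> k \<in> L2 M"
    and lim: "(\<lambda>m. L2_norm M (\<lambda>x. f x - (\<Sum>k=1..m. \<theta> k * \<phi> k x))) \<longlonglongrightarrow> 0"
  shows "(\<lambda>m. \<Sum>k=1..m. \<theta> k * L2_inner M (\<phi> k) h) \<longlonglongrightarrow> L2_inner M f h"
proof -
  let ?S = "\<lambda>m x. \<Sum>k=1..m. \<theta> k * \<phi> k x"
  have S: "?S m \<in> L2 M" for m using \<phi> by (intro L2_sum) auto
  have bound: "norm (L2_inner M f h - (\<Sum>k=1..m. \<theta> k * L2_inner M (\<phi> k) h))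
      \<le> L2_norm M (\<lambda>x. f x - ?S m x) * L2_norm M h" for m
  proof -
    have "L2_inner M f h - (\<Sum>k=1..m. \<theta> k * L2_inner M (\<phi> k) h) = L2_inner M (\<lambda>x. f x - ?S m x) h"
      using L2_inner_diff_left[OF f S h] L2_inner_sum_left[of "{1..m}" \<phi> M h \<theta>] \<phi> h by simp
    then show ?thesis using L2_Cauchy_Schwarz[OF L2_diff[OF f S] h] by simp
  qed
  have "(\<lambda>m. L2_norm M (\<lambda>x. f x - ?S m x) * L2_norm M h) \<longlonglongrightarrow> 0 * L2_norm M h"
    by (intro tendsto_mult lim tendsto_const)
  then have lim0: "(\<lambda>m. L2_norm M (\<lambda>x. f x - ?S m x) * L2_norm M h) \<longlonglongrightarrow> 0"
    by simp
  have "(\<lambda>m. L2_inner M f h - (\<Sum>k=1..m. \<theta> k * L2_inner M (\<phi> k) h)) \<longlonglongrightarrow> 0"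
    by (rule Lim_null_comparison[OF always_eventually[OF allI[OF bound]] lim0])
  then have "(\<lambda>m. L2_inner M f h - (L2_inner M f h - (\<Sum>k=1..m. \<theta> k * L2_inner M (\<phi> k) h)))
      \<longlonglongrightarrow> L2_inner M f h - 0" by (intro tendsto_diff tendsto_const)
  then show ?thesis by simp
qed

text \<open>Beyond \<open>N\<close> the ellipsoid weights are at least
  \<open>N powr (2 * \<gamma>)\<close>, so the tail of \<open>f\<close> has norm at most
  \<open>sqrt L * N powr (- \<gamma>)\<close>; Cauchy-Schwarz pairs it with
  \<open>h\<close>.\<close>

lemma ellipsoid_truncation_error:
  assumes basis: "orthonormal_basis M \<phi>" and f: "f \<in> ellipsoid M \<phi> \<gamma> L" and h: "h \<in> L2 M"
    and \<gamma>: "\<gamma> \<ge> 0" and L: "L \<ge> 0" and N: "N \<ge> 1"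
  shows "\<bar>L2_inner M f h - (\<Sum>k=1..N. L2_inner M f (\<phi> k) * L2_inner M (\<phi> k) h)\<bar>
    \<le> sqrt L * real N powr (- \<gamma>) * L2_norm M h"
proof -
  have \<phi>: "\<phi> k \<in> L2 M" if "k \<ge> 1" for k using basis that by (auto simp: orthonormal_basis_def)
  have orth: "L2_inner M (\<phi> j) (\<phi> k) = (if j = k then 1 else 0)" if "j \<ge> 1" "k \<ge> 1" for j k
    using basis that by (auto simp: orthonormal_basis_def)
  obtain \<theta> where fL2: "f \<in> L2 M"
    and lim: "(\<lambda>m. L2_norm M (\<lambda>x. f x - (\<Sum>k=1..m. \<theta> k * \<phi> k x))) \<longlonglongrightarrow> 0"
    and summ: "(\<lambda>k. (\<theta> k)\<^sup>2 * real k powr (2 * \<gamma>)) summable_on {1..}"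
    and le: "(\<Sum>\<^sub>\<infinity>k\<in>{1..}. (\<theta> k)\<^sup>2 * real k powr (2 * \<gamma>)) \<le> L"
    using f by (auto simp: ellipsoid_def)
  \<comment> \<open>Tested against \<open>\<phi> j\<close>, the partial sums are constant from index
    \<open>j\<close> on, so the coefficients in the ellipsoid condition are the inner
    products.\<close>
  have coeff: "L2_inner M f (\<phi> j) = \<theta> j" if j: "j \<ge> 1" for j
  proof (rule LIMSEQ_unique[OF L2_inner_expansion[OF fL2 \<phi>[OF j] \<phi> lim]])
    have "(\<Sum>k=1..m. \<theta> k * L2_inner M (\<phi> k) (\<phi> j)) = \<theta> j" if "m \<ge> j" for m
    proof -
      have "(\<Sum>k=1..m. \<theta> k * L2_inner M (\<phi> k) (\<phi> j)) = (\<Sum>k=1..m. if k = j then \<theta> k else 0)"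
        using j by (intro sum.cong) (auto simp: orth)
      then show ?thesis using that j by simp
    qed
    then show "(\<lambda>m. \<Sum>k=1..m. \<theta> k * L2_inner M (\<phi> k) (\<phi> j)) \<longlonglongrightarrow> \<theta> j"
      by (intro tendsto_eventually eventually_sequentiallyI[of j])
  qed
  let ?a = "\<lambda>k. \<theta> k * L2_inner M (\<phi> k) h"
  \<comment> \<open>The tail is first cut at a finite \<open>m\<close>; the bound is uniform in
    \<open>m\<close> and survives the limit.\<close>
  have tail: "\<bar>(\<Sum>k=1..m. ?a k) - (\<Sum>k=1..N. ?a k)\<bar> \<le> sqrt L * real N powr (- \<gamma>) * L2_norm M h"
    if m: "m \<ge> N" for m
  proof -
    let ?T = "\<lambda>x. \<Sum>k\<in>{N<..m}. \<theta> k * \<phi> k x"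
    have T: "?T \<in> L2 M" using \<phi> by (intro L2_sum) auto
    have "{1..m} = {1..N} \<union> {N<..m}" using m N by auto
    then have "(\<Sum>k=1..m. ?a k) = (\<Sum>k=1..N. ?a k) + (\<Sum>k\<in>{N<..m}. ?a k)"
      by (simp add: sum.union_disjoint Int_def)
    moreover have "(\<Sum>k\<in>{N<..m}. ?a k) = L2_inner M ?T h"
      using \<phi> h by (subst L2_inner_sum_left) auto
    ultimately have "\<bar>(\<Sum>k=1..m. ?a k) - (\<Sum>k=1..N. ?a k)\<bar> \<le> L2_norm M ?T * L2_norm M h"
      using L2_Cauchy_Schwarz[OF T h] by simp
    also have "\<dots> \<le> (sqrt L * real N powr (- \<gamma>)) * L2_norm M h"
    proof (intro mult_right_mono L2_norm_nonneg)
      have "(L2_norm M ?T)\<^sup>2 = (\<Sum>k\<in>{N<..m}. (\<theta> k)\<^sup>2)"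
        using \<phi> orth by (intro L2_norm_orthonormal_sum) auto
      also have "\<dots> \<le> (\<Sum>k\<in>{N<..m}. real N powr (- (2 * \<gamma>)) * ((\<theta> k)\<^sup>2 * real k powr (2 * \<gamma>)))"
      proof (rule sum_mono)
        fix k assume "k \<in> {N<..m}"
        then have "real N powr (2 * \<gamma>) \<le> real k powr (2 * \<gamma>)" using \<gamma> by (intro powr_mono2) auto
        then have "1 \<le> real N powr (- (2 * \<gamma>)) * real k powr (2 * \<gamma>)"
          using N by (simp add: powr_minus field_simps)
        then have "(\<theta> k)\<^sup>2 * 1 \<le> (\<theta> k)\<^sup>2 * (real N powr (- (2 * \<gamma>)) * real k powr (2 * \<gamma>))"
          by (intro mult_left_mono) auto
        then show "(\<theta> k)\<^sup>2 \<le> real N powr (- (2 * \<gamma>)) * ((\<theta> k)\<^sup>2 * real k powr (2 * \<gamma>))"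
          by (simp add: mult_ac)
      qed
      also have "\<dots> = real N powr (- (2 * \<gamma>)) * (\<Sum>k\<in>{N<..m}. (\<theta> k)\<^sup>2 * real k powr (2 * \<gamma>))"
        by (simp add: sum_distrib_left)
      also have "\<dots> \<le> real N powr (- (2 * \<gamma>)) * L"
      proof (rule mult_left_mono)
        have "(\<Sum>k\<in>{N<..m}. (\<theta> k)\<^sup>2 * real k powr (2 * \<gamma>))
            \<le> (\<Sum>\<^sub>\<infinity>k\<in>{1..}. (\<theta> k)\<^sup>2 * real k powr (2 * \<gamma>))"
          by (rule finite_sum_le_infsum[OF summ]) auto
        with le show "(\<Sum>k\<in>{N<..m}. (\<theta> k)\<^sup>2 * real k powr (2 * \<gamma>)) \<le> L" by simp
      qed simp
      also have "\<dots> = (sqrt L * real N powr (- \<gamma>))\<^sup>2"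
      proof -
        have "real N powr (- (2 * \<gamma>)) = (real N powr (- \<gamma>))\<^sup>2"
          by (simp add: power2_eq_square powr_add[symmetric])
        then show ?thesis using L by (simp add: power_mult_distrib)
      qed
      finally show "L2_norm M ?T \<le> sqrt L * real N powr (- \<gamma>)"
        using L by (intro power2_le_imp_le[OF _ mult_nonneg_nonneg]) auto
    qed
    finally show ?thesis .
  qed
  have "(\<lambda>m. \<bar>(\<Sum>k=1..m. ?a k) - (\<Sum>k=1..N. ?a k)\<bar>) \<longlonglongrightarrow> \<bar>L2_inner M f h - (\<Sum>k=1..N. ?a k)\<bar>"
    by (intro tendsto_rabs tendsto_diff tendsto_const L2_inner_expansion[OF fL2 h \<phi> lim])
  then have "\<bar>L2_inner M f h - (\<Sum>k=1..N. ?a k)\<bar> \<le> sqrt L * real N powr (- \<gamma>) * L2_norm M h"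
    by (rule LIMSEQ_le_const2) (use tail in auto)
  moreover have "(\<Sum>k=1..N. L2_inner M f (\<phi> k) * L2_inner M (\<phi> k) h) = (\<Sum>k=1..N. ?a k)"
    by (intro sum.cong) (auto simp: coeff)
  ultimately show ?thesis by simp
qed

section \<open>Peeling and rates\<close>

text \<open>On the shell from \<open>s\<close> to \<open>2 * s\<close> the variable costs at most
  \<open>2 * s\<close> and \<open>F s\<close> occurs. Along \<open>s = 2 ^ j * s0\<close> the cost
  grows like \<open>2 ^ j\<close> and the probability decays like
  \<open>2 powr (- j * (1 + \<theta>))\<close>, which leaves a geometric series of ratio
  \<open>2 powr (- \<theta>)\<close>.\<close>

lemma (in prob_space) expectation_le_by_peeling:
  fixes r :: "'a \<Rightarrow> real" and s0 K \<theta> :: real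
  assumes r: "r \<in> borel_measurable M" "\<And>\<omega>. \<omega> \<in> space M \<Longrightarrow> 0 \<le> r \<omega> \<and> r \<omega> \<le> 1"
    and s0: "s0 > 0" and K: "K \<ge> 0" and \<theta>: "\<theta> > 0"
    and F: "\<And>s. s0 \<le> s \<Longrightarrow> F s \<in> events"
    and prob_F: "\<And>s. s0 \<le> s \<Longrightarrow> prob (F s) \<le> K * (s0 / s) powr (1 + \<theta>)"
    and shell: "\<And>s \<omega>. s0 \<le> s \<Longrightarrow> \<omega> \<in> space M \<Longrightarrow> s < r \<omega> \<Longrightarrow> r \<omega> \<le> 2 * s \<Longrightarrow> \<omega> \<in> F s"
  shows "expectation r \<le> (1 + 2 * K / (1 - 2 powr (- \<theta>))) * s0"
proof -
  define s where "s j = 2 ^ j * s0" for j :: nat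
  have s_ge: "s0 \<le> s j" for j using s0 by (simp add: s_def)
  have s_Suc: "s (Suc j) = 2 * s j" for j by (simp add: s_def)
  \<comment> \<open>Since \<open>r \<le> 1\<close>, finitely many shells suffice.\<close>
  obtain J where "1 / s0 < 2 ^ J" using real_arch_pow[of 2 "1 / s0"] by auto
  then have J: "1 \<le> s J" using s0 by (simp add: s_def field_simps)
  have int_r: "integrable M r"
    by (rule integrable_const_bound[of _ 1]) (use r in auto)
  \<comment> \<open>Raising the level from \<open>s m\<close> to \<open>s (Suc m)\<close> either
    changes nothing or puts the point in shell \<open>m\<close>, whose single term already dominates
    \<open>r \<omega>\<close>.\<close>
  have step: "r \<omega> \<le> s0 + (\<Sum>j<m. 2 * s j * indicator (F (s j)) \<omega>)"
    if \<omega>: "\<omega> \<in> space M" and "r \<omega> \<le> s m" for m \<omega>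
    using \<open>r \<omega> \<le> s m\<close>
  proof (induction m)
    case 0 then show ?case by (simp add: s_def)
  next
    case (Suc m)
    have nn: "0 \<le> 2 * s m * indicator (F (s m)) \<omega>" "0 \<le> (\<Sum>j<m. 2 * s j * indicator (F (s j)) \<omega>)"
      using s0 by (auto simp: s_def intro!: sum_nonneg)
    show ?case
    proof (cases "r \<omega> \<le> s m")
      case True then show ?thesis using Suc.IH nn by simp
    next
      case False
      then have "\<omega> \<in> F (s m)" using shell[OF s_ge \<omega>, of m] Suc.prems by (simp add: s_Suc)
      then show ?thesis using Suc.prems nn s0 by (simp add: s_Suc)
    qed
  qed
  have int_F: "integrable M (\<lambda>\<omega>. 2 * s j * indicator (F (s j)) \<omega>)" for j
    using F[OF s_ge] by (intro integrable_mult_right integrable_real_indicator) (auto simp: emeasure_eq_measure)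
  have exp_F: "expectation (\<lambda>\<omega>. 2 * s j * indicator (F (s j)) \<omega>) = 2 * s j * prob (F (s j))" for j
    using F[OF s_ge] sets.sets_into_space[OF F[OF s_ge]] by (simp add: Int_absorb2)
  have "expectation r \<le> expectation (\<lambda>\<omega>. s0 + (\<Sum>j<J. 2 * s j * indicator (F (s j)) \<omega>))"
  proof (rule integral_mono[OF int_r])
    show "integrable M (\<lambda>\<omega>. s0 + (\<Sum>j<J. 2 * s j * indicator (F (s j)) \<omega>))"
      by (intro Bochner_Integration.integrable_add Bochner_Integration.integrable_sum int_F integrable_const)
    show "r \<omega> \<le> s0 + (\<Sum>j<J. 2 * s j * indicator (F (s j)) \<omega>)" if "\<omega> \<in> space M" for \<omega>
      using step[OF that, of J] r(2)[OF that] J by linarith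
  qed
  also have "\<dots> = s0 + (\<Sum>j<J. 2 * s j * prob (F (s j)))"
    unfolding exp_F[symmetric]
    by (subst Bochner_Integration.integral_add; (subst Bochner_Integration.integral_sum)?)
      (intro Bochner_Integration.integrable_sum int_F integrable_const | simp add: prob_space)+
  also have "\<dots> \<le> s0 + (\<Sum>j<J. 2 * K * s0 * (2 powr (- \<theta>)) ^ j)"
  proof (intro add_mono order_refl sum_mono)
    fix j
    have "2 * s j * prob (F (s j)) \<le> 2 * s j * (K * (s0 / s j) powr (1 + \<theta>))"
      using s_ge[of j] s0 prob_F[OF s_ge] by (intro mult_left_mono) auto
    also have "s0 / s j = 2 powr (- real j)"
      using s0 by (simp add: s_def powr_minus powr_realpow divide_inverse)
    also have "(2 powr (- real j)) powr (1 + \<theta>) = 2 powr (- real j) * (2 powr (- \<theta>)) powr real j"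
      by (simp add: powr_powr powr_add[symmetric] algebra_simps)
    also have "(2 powr (- \<theta>)) powr real j = (2 powr (- \<theta>)) ^ j" by (simp add: powr_realpow)
    also have "2 * s j * (K * (2 powr (- real j) * (2 powr (- \<theta>)) ^ j)) = 2 * K * s0 * (2 powr (- \<theta>)) ^ j"
      by (simp add: s_def powr_minus powr_realpow field_simps)
    finally show "2 * s j * prob (F (s j)) \<le> 2 * K * s0 * (2 powr (- \<theta>)) ^ j" .
  qed
  also have "(\<Sum>j<J. 2 * K * s0 * (2 powr (- \<theta>)) ^ j) \<le> 2 * K * s0 * (1 / (1 - 2 powr (- \<theta>)))"
  proof -
    have lt: "2 powr (- \<theta>) < (1::real)" using \<theta> by (simp add: powr_less_one)
    have "(\<Sum>j<J. (2 powr (- \<theta>)) ^ j) \<le> (\<Sum>j. (2 powr (- \<theta>)) ^ j)"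
      using lt by (intro sum_le_suminf summable_geometric) auto
    also have "\<dots> = 1 / (1 - 2 powr (- \<theta>))" using lt by (intro suminf_geometric) simp
    finally show ?thesis
      unfolding sum_distrib_left[symmetric] using K s0 by (intro mult_left_mono) auto
  qed
  finally show ?thesis by (simp add: algebra_simps)
qed

text \<open>Balance equations for the unrounded cut-off \<open>t\<close> and the target rate
  \<open>s\<close>: the bias \<open>t powr (- \<gamma>) * s powr (1 / (2 * \<kappa>))\<close> and
  the noise \<open>t powr \<beta> / sqrt n * s powr ((1 - \<rho>) / (2 * \<kappa>))\<close> both
  equal \<open>s\<close>.\<close>

lemma rate_exponents:
  fixes n t \<kappa> \<gamma> \<beta> \<rho> :: real
  assumes n: "n > 0" and params: "\<gamma> > 0" "\<kappa> \<ge> 1" "0 < \<rho>" "\<beta> \<ge> 0"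
  defines "t \<equiv> n powr ((2 * \<kappa> - 1) / (2 * \<gamma> * (2 * \<kappa> + \<rho> - 1) + 2 * (2 * \<kappa> - 1) * \<beta>))"
    and "s \<equiv> n powr (- (\<kappa> * \<gamma> / (\<gamma> * (2 * \<kappa> + \<rho> - 1) + (2 * \<kappa> - 1) * \<beta>)))"
  shows "t powr (- \<gamma>) = s powr ((2 * \<kappa> - 1) / (2 * \<kappa>))"
    and "t powr (2 * \<beta>) / n = s powr ((2 * \<kappa> - 1 + \<rho>) / \<kappa>)"
proof -
  define E where "E = \<gamma> * (2 * \<kappa> + \<rho> - 1) + (2 * \<kappa> - 1) * \<beta>"
  have E: "E > 0" unfolding E_def using params by (intro add_pos_nonneg mult_pos_pos) auto
  have t: "t = n powr ((2 * \<kappa> - 1) / (2 * E))" unfolding t_def E_def by (simp add: algebra_simps)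
  have s: "s = n powr (- (\<kappa> * \<gamma> / E))" unfolding s_def E_def ..
  have "(2 * \<kappa> - 1) / (2 * E) * (- \<gamma>) = - (\<kappa> * \<gamma> / E) * ((2 * \<kappa> - 1) / (2 * \<kappa>))"
    using E params by (simp add: divide_simps)
  then show "t powr (- \<gamma>) = s powr ((2 * \<kappa> - 1) / (2 * \<kappa>))"
    unfolding t s powr_powr by simp
  have "(2 * \<kappa> - 1) / (2 * E) * (2 * \<beta>) - 1 = ((2 * \<kappa> - 1) * \<beta> - E) / E"
    using E by (simp add: field_simps)
  also have "(2 * \<kappa> - 1) * \<beta> - E = - (\<gamma> * (2 * \<kappa> + \<rho> - 1))" by (simp add: E_def)
  also have "- (\<gamma> * (2 * \<kappa> + \<rho> - 1)) / E = - (\<kappa> * \<gamma> / E) * ((2 * \<kappa> - 1 + \<rho>) / \<kappa>)"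
    using E params by (simp add: divide_simps)
  finally have "n powr ((2 * \<kappa> - 1) / (2 * E) * (2 * \<beta>) - 1)
      = n powr (- (\<kappa> * \<gamma> / E) * ((2 * \<kappa> - 1 + \<rho>) / \<kappa>))" by simp
  then show "t powr (2 * \<beta>) / n = s powr ((2 * \<kappa> - 1 + \<rho>) / \<kappa>)"
    unfolding t s powr_powr powr_diff using n by simp
qed

text \<open>Rounding moves the cut-off by at most a factor two, which affects only constants in the
  rate.\<close>

lemma rounding_bounds:
  fixes t :: real
  assumes "t \<ge> 1" "N = nat \<lfloor>t\<rfloor> \<or> N = nat \<lceil>t\<rceil>"
  shows "N \<ge> 1" "t / 2 \<le> real N" "real N \<le> 2 * t"
proof -
  have fl: "1 \<le> \<lfloor>t\<rfloor>" "real_of_int \<lfloor>t\<rfloor> \<le> t" "t < real_of_int \<lfloor>t\<rfloor> + 1"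
    using assms(1) by linarith+
  have ce: "t \<le> real_of_int \<lceil>t\<rceil>" "real_of_int \<lceil>t\<rceil> < t + 1" by linarith+
  have fl1: "1 \<le> real_of_int \<lfloor>t\<rfloor>" using fl(1) by simp
  have "real N = real_of_int \<lfloor>t\<rfloor> \<or> real N = real_of_int \<lceil>t\<rceil>"
    using assms by auto
  then have "1 \<le> real N \<and> t / 2 \<le> real N \<and> real N \<le> 2 * t"
  proof
    assume "real N = real_of_int \<lfloor>t\<rfloor>"
    with fl fl1 show ?thesis by linarith
  next
    assume "real N = real_of_int \<lceil>t\<rceil>"
    with ce assms(1) show ?thesis by linarith
  qed
  then show "N \<ge> 1" "t / 2 \<le> real N" "real N \<le> 2 * t" by auto
qed

section \<open>Spectral cut-off\<close>

context labelled_measure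
begin

text \<open>Jensen's inequality for the label law, obtained from the nonnegative variance of the
  slice norms around their mean \<open>m\<close>.\<close>

lemma L2_norm_labelled:
  fixes h :: "'a \<times> nat \<Rightarrow> real"
  assumes h: "\<And>y. y \<le> M \<Longrightarrow> (\<lambda>x. h (x, y)) \<in> L2 \<nu>"
  shows "(\<Sum>y\<le>M. p y * L2_norm \<nu> (\<lambda>x. h (x, y))) \<le> L2_norm \<nu>Y h"
proof -
  let ?a = "\<lambda>y. L2_norm \<nu> (\<lambda>x. h (x, y))"
  define m where "m = (\<Sum>y\<le>M. p y * ?a y)"
  have "(L2_norm \<nu>Y h)\<^sup>2 = (\<Sum>y\<le>M. p y * (?a y)\<^sup>2)"
    unfolding L2_norm_power2 using h by (subst integral_labelled) (auto simp: L2_def)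
  moreover have "0 \<le> (\<Sum>y\<le>M. p y * (?a y - m)\<^sup>2)"
    by (intro sum_nonneg mult_nonneg_nonneg) (auto simp: p_nonneg)
  moreover have "(\<Sum>y\<le>M. p y * (?a y - m)\<^sup>2)
      = (\<Sum>y\<le>M. p y * (?a y)\<^sup>2 - 2 * m * (p y * ?a y) + m\<^sup>2 * p y)"
    by (intro sum.cong refl) (simp add: power2_eq_square algebra_simps)
  moreover have "\<dots> = (\<Sum>y\<le>M. p y * (?a y)\<^sup>2) - 2 * m * m + m\<^sup>2 * 1"
    unfolding sum.distrib sum_subtractf sum_distrib_left[symmetric] p_sum m_def ..
  ultimately have "m\<^sup>2 \<le> (L2_norm \<nu>Y h)\<^sup>2" by (simp add: power2_eq_square)
  then show ?thesis unfolding m_def by (rule power2_le_imp_le) (rule L2_norm_nonneg)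
qed

end

section \<open>The cut-off loss and its centred increments\<close>

locale spectral_cutoff =
  X: labelled_measure \<nu>\<^sub>X M p + Z: labelled_measure \<nu>\<^sub>Z M p
  for \<nu>\<^sub>X :: "'a measure" and \<nu>\<^sub>Z :: "'b measure" and M :: nat and p :: "nat \<Rightarrow> real" +
  fixes A :: "('a \<Rightarrow> real) \<Rightarrow> ('b \<Rightarrow> real)" and A' :: "('b \<Rightarrow> real) \<Rightarrow> ('a \<Rightarrow> real)"
    and b :: "nat \<Rightarrow> real" and \<phi> :: "nat \<Rightarrow> 'a \<Rightarrow> real" and \<psi> :: "nat \<Rightarrow> 'b \<Rightarrow> real"
    and loss :: "real \<Rightarrow> nat \<Rightarrow> real" and G :: "('a \<Rightarrow> real) set"
  assumes linear: "L2_linear \<nu>\<^sub>X \<nu>\<^sub>Z A"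
    and adjoint: "L2_adjoint \<nu>\<^sub>X \<nu>\<^sub>Z A A'"
    and svd: "singular_value_decomposition \<nu>\<^sub>X \<nu>\<^sub>Z A A' b \<phi> \<psi>"
    and loss01: "y \<le> M \<Longrightarrow> 0 \<le> loss u y \<and> loss u y \<le> 1"
    and loss_L2: "g \<in> G \<Longrightarrow> y \<le> M \<Longrightarrow> (\<lambda>x. loss (g x) y) \<in> L2 \<nu>\<^sub>X"
begin

abbreviation cut :: "nat \<Rightarrow> ('a \<Rightarrow> real) \<Rightarrow> 'b \<times> nat \<Rightarrow> real" where
  "cut \<equiv> cutoff_loss \<nu>\<^sub>X b \<phi> \<psi> loss"

lemma basis: "orthonormal_basis \<nu>\<^sub>X \<phi>"
  using svd by (simp add: singular_value_decomposition_def)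

lemma \<phi>_L2: "k \<ge> 1 \<Longrightarrow> \<phi> k \<in> L2 \<nu>\<^sub>X"
  using basis by (simp add: orthonormal_basis_def)

lemma \<psi>_L2: "k \<ge> 1 \<Longrightarrow> \<psi> k \<in> L2 \<nu>\<^sub>Z"
  using svd by (simp add: singular_value_decomposition_def)

lemma b_pos: "k \<ge> 1 \<Longrightarrow> b k > 0"
  using svd by (simp add: singular_value_decomposition_def)

text \<open>The adjoint moves \<open>A\<close> onto \<open>\<psi> k\<close>. The coefficient of
  \<open>h\<close> is thus recovered from \<open>A h\<close> upon division by \<open>b k\<close>,
  which explains the weights of the cut-off loss.\<close>

lemma inner_A_\<psi>:
  assumes h: "h \<in> L2 \<nu>\<^sub>X" and k: "k \<ge> 1"
  shows "L2_inner \<nu>\<^sub>Z (A h) (\<psi> k) = b k * L2_inner \<nu>\<^sub>X h (\<phi> k)"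
proof -
  have ae: "AE x in \<nu>\<^sub>X. A' (\<psi> k) x = b k * \<phi> k x"
    using svd k by (simp add: singular_value_decomposition_def)
  have L2: "A' (\<psi> k) \<in> L2 \<nu>\<^sub>X"
    using adjoint \<psi>_L2[OF k] by (auto simp: L2_adjoint_def L2_linear_def)
  have meas: "h \<in> borel_measurable \<nu>\<^sub>X" "\<phi> k \<in> borel_measurable \<nu>\<^sub>X" "A' (\<psi> k) \<in> borel_measurable \<nu>\<^sub>X"
    using h \<phi>_L2[OF k] L2 by (auto simp: L2_def)
  have "L2_inner \<nu>\<^sub>Z (A h) (\<psi> k) = L2_inner \<nu>\<^sub>X h (A' (\<psi> k))"
    using adjoint h \<psi>_L2[OF k] by (auto simp: L2_adjoint_def)
  also have "\<dots> = (\<integral>x. b k * (h x * \<phi> k x) \<partial>\<nu>\<^sub>X)"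
    unfolding L2_inner_def
    by (rule integral_cong_AE) (use ae meas in \<open>auto elim!: AE_mp\<close>)
  finally show ?thesis by (simp add: L2_inner_def)
qed

lemma cut_eq:
  "cut N g (z, y) =
    (\<Sum>k=1..N. (inverse (b k) * L2_inner \<nu>\<^sub>X (\<phi> k) (\<lambda>x. loss (g x) y)) * \<psi> k z)"
  by (simp add: cutoff_loss_def L2_inner_def)

lemma cut_L2: "(\<lambda>z. cut N g (z, y)) \<in> L2 \<nu>\<^sub>Z"
  unfolding cut_eq by (intro L2_sum \<psi>_L2) auto

text \<open>The increments live on the observation space, whereas the radius is measured for the
  original losses on the space of \<open>X\<close>. Centring at the mean under \<open>Q\<close> puts
  the maximal inequality within reach.\<close>

definition centred_increments ::
    "('b \<times> nat) measure \<Rightarrow> nat \<Rightarrow> real \<Rightarrow> ('b \<times> nat \<Rightarrow> real) set" where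
  "centred_increments Q N \<delta> =
     (\<lambda>(g, g') w. (cut N g w - cut N g' w) - (\<integral>w. cut N g w - cut N g' w \<partial>Q)) `
     {(g, g'). g \<in> G \<and> g' \<in> G \<and> L2_norm X.\<nu>Y (\<lambda>w. loss_of loss g w - loss_of loss g' w) \<le> \<delta>}"

text \<open>This passes from the normalised deviations in \<open>expected_modulus\<close> to plain
  sums over a centred class.\<close>

lemma sup_sum_centred_increments:
  assumes "m > 0"
  shows "(\<Squnion>(g, g') \<in> {(g, g'). g \<in> G \<and> g' \<in> G \<and>
            L2_norm X.\<nu>Y (\<lambda>w. loss_of loss g w - loss_of loss g' w) \<le> \<delta>}.
          ennreal \<bar>(\<integral>w. cut N g w - cut N g' w \<partial>Q) - emp_mean m s (\<lambda>w. cut N g w - cut N g' w)\<bar>)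
    = ennreal (1 / m) * sup_sum (centred_increments Q N \<delta>) {..<m} s"
proof -
  have "\<bar>c - emp_mean m s T\<bar> = (1 / m) * \<bar>\<Sum>i<m. T (s i) - c\<bar>" for c and T :: "'b \<times> nat \<Rightarrow> real"
  proof -
    have "c - emp_mean m s T = - ((1 / m) * (\<Sum>i<m. T (s i) - c))"
      using assms by (simp add: emp_mean_def sum_subtractf field_simps)
    then show ?thesis by (simp add: abs_mult)
  qed
  then have *: "ennreal \<bar>c - emp_mean m s T\<bar> = ennreal (1 / m) * ennreal \<bar>\<Sum>i<m. T (s i) - c\<bar>"
    for c and T :: "'b \<times> nat \<Rightarrow> real"
    by (simp add: ennreal_mult[symmetric])
  show ?thesis
    unfolding * sup_sum_def centred_increments_def SUP_mult_left_ennreal image_image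
    by (intro SUP_cong) auto
qed

section \<open>Risk, bias and noise for fixed conditional densities\<close>

context
  fixes f :: "nat \<Rightarrow> 'a \<Rightarrow> real" and \<gamma> L :: real
  assumes f_regular: "y \<le> M \<Longrightarrow> f y \<in> regular_densities \<nu>\<^sub>X \<phi> \<gamma> L"
    and Af_density: "y \<le> M \<Longrightarrow> prob_density \<nu>\<^sub>Z (A (f y))"
begin

abbreviation P :: "('a \<times> nat) measure" where "P \<equiv> joint_law \<nu>\<^sub>X M p f"
abbreviation Pt :: "('b \<times> nat) measure" where "Pt \<equiv> joint_law \<nu>\<^sub>Z M p (\<lambda>y. A (f y))"

lemma f_L2: "y \<le> M \<Longrightarrow> f y \<in> L2 \<nu>\<^sub>X"
  using f_regular by (auto simp: regular_densities_def ellipsoid_def)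

lemma f_density: "y \<le> M \<Longrightarrow> prob_density \<nu>\<^sub>X (f y)"
  using f_regular by (auto simp: regular_densities_def)

lemma prob_space_P: "prob_space P"
  by (rule X.prob_space_joint_law) (rule f_density)

lemma prob_space_Pt: "prob_space Pt"
  by (rule Z.prob_space_joint_law) (rule Af_density)

lemma risk_eq:
  assumes g: "g \<in> G"
  shows "integrable P (loss_of loss g)"
    and "risk loss P g = (\<Sum>y\<le>M. p y * L2_inner \<nu>\<^sub>X (f y) (\<lambda>x. loss (g x) y))"
proof -
  have meas: "(\<lambda>x. loss_of loss g (x, y)) \<in> borel_measurable \<nu>\<^sub>X" if "y \<le> M" for y
    using loss_L2[OF g that] by (simp add: L2_def loss_of_def)
  have int: "integrable \<nu>\<^sub>X (\<lambda>x. f y x * loss_of loss g (x, y))" if "y \<le> M" for y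
    using L2_mult_integrable[OF f_L2[OF that] loss_L2[OF g that]] by (simp add: loss_of_def)
  show "integrable P (loss_of loss g)"
    by (rule X.integral_joint_law(1)[OF f_density meas int])
  have "risk loss P g = (\<Sum>y\<le>M. p y * (\<integral>x. f y x * loss_of loss g (x, y) \<partial>\<nu>\<^sub>X))"
    unfolding risk_def by (rule X.integral_joint_law(2)[OF f_density meas int])
  then show "risk loss P g = (\<Sum>y\<le>M. p y * L2_inner \<nu>\<^sub>X (f y) (\<lambda>x. loss (g x) y))"
    by (simp add: L2_inner_def loss_of_def)
qed

lemma risk_01:
  assumes g: "g \<in> G"
  shows "0 \<le> risk loss P g" "risk loss P g \<le> 1"
proof -
  interpret prob_space P by (rule prob_space_P)
  have bd: "0 \<le> loss_of loss g w \<and> loss_of loss g w \<le> 1" if "w \<in> space P" for w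
    using that loss01 by (auto simp: loss_of_def)
  show "0 \<le> risk loss P g"
    unfolding risk_def using bd by (intro integral_nonneg_AE AE_I2) auto
  show "risk loss P g \<le> 1"
    unfolding risk_def using bd by (intro integral_le_const risk_eq(1) g AE_I2) auto
qed

text \<open>Unbiasedness: under the density \<open>A (f y)\<close> the function
  \<open>\<psi> k\<close> has mean \<open>b k\<close> times the coefficient of \<open>f y\<close>,
  and the weight \<open>inverse (b k)\<close> cancels that factor. What remains is the risk with its
  expansion truncated at \<open>N\<close>.\<close>

lemma cut_mean:
  shows "integrable Pt (cut N g)"
    and "(\<integral>w. cut N g w \<partial>Pt) = (\<Sum>y\<le>M. p y *
      (\<Sum>k=1..N. L2_inner \<nu>\<^sub>X (f y) (\<phi> k) * L2_inner \<nu>\<^sub>X (\<phi> k) (\<lambda>x. loss (g x) y)))"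
proof -
  have Af: "A (f y) \<in> L2 \<nu>\<^sub>Z" if "y \<le> M" for y
    using linear f_L2[OF that] by (auto simp: L2_linear_def)
  have meas: "(\<lambda>z. cut N g (z, y)) \<in> borel_measurable \<nu>\<^sub>Z" for y
    using cut_L2 by (simp add: L2_def)
  have int: "integrable \<nu>\<^sub>Z (\<lambda>z. A (f y) z * cut N g (z, y))" if "y \<le> M" for y
    by (rule L2_mult_integrable[OF Af[OF that] cut_L2])
  show "integrable Pt (cut N g)"
    by (rule Z.integral_joint_law(1)[OF Af_density meas int])
  have "(\<integral>w. cut N g w \<partial>Pt) = (\<Sum>y\<le>M. p y * L2_inner \<nu>\<^sub>Z (A (f y)) (\<lambda>z. cut N g (z, y)))"
    unfolding L2_inner_def by (rule Z.integral_joint_law(2)[OF Af_density meas int])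
  also have "\<dots> = (\<Sum>y\<le>M. p y *
      (\<Sum>k=1..N. L2_inner \<nu>\<^sub>X (f y) (\<phi> k) * L2_inner \<nu>\<^sub>X (\<phi> k) (\<lambda>x. loss (g x) y)))"
  proof (intro sum.cong refl arg_cong2[where f="(*)"])
    fix y assume "y \<in> {..M}"
    then have y: "y \<le> M" by simp
    let ?c = "\<lambda>k. inverse (b k) * L2_inner \<nu>\<^sub>X (\<phi> k) (\<lambda>x. loss (g x) y)"
    have "L2_inner \<nu>\<^sub>Z (A (f y)) (\<lambda>z. cut N g (z, y)) = (\<Sum>k=1..N. ?c k * L2_inner \<nu>\<^sub>Z (\<psi> k) (A (f y)))"
      unfolding cut_eq L2_inner_commute[of \<nu>\<^sub>Z "A (f y)"]
      by (rule L2_inner_sum_left) (auto intro: \<psi>_L2 Af y)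
    also have "\<dots> = (\<Sum>k=1..N. L2_inner \<nu>\<^sub>X (f y) (\<phi> k) * L2_inner \<nu>\<^sub>X (\<phi> k) (\<lambda>x. loss (g x) y))"
    proof (rule sum.cong[OF refl])
      fix k assume "k \<in> {1..N}"
      then have k: "k \<ge> 1" by simp
      show "?c k * L2_inner \<nu>\<^sub>Z (\<psi> k) (A (f y))
          = L2_inner \<nu>\<^sub>X (f y) (\<phi> k) * L2_inner \<nu>\<^sub>X (\<phi> k) (\<lambda>x. loss (g x) y)"
        unfolding L2_inner_commute[of \<nu>\<^sub>Z "\<psi> k"] inner_A_\<psi>[OF f_L2[OF y] k]
        using b_pos[OF k] by simp
    qed
    finally show "L2_inner \<nu>\<^sub>Z (A (f y)) (\<lambda>z. cut N g (z, y))
      = (\<Sum>k=1..N. L2_inner \<nu>\<^sub>X (f y) (\<phi> k) * L2_inner \<nu>\<^sub>X (\<phi> k) (\<lambda>x. loss (g x) y))" .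
  qed
  finally show "(\<integral>w. cut N g w \<partial>Pt) = (\<Sum>y\<le>M. p y *
      (\<Sum>k=1..N. L2_inner \<nu>\<^sub>X (f y) (\<phi> k) * L2_inner \<nu>\<^sub>X (\<phi> k) (\<lambda>x. loss (g x) y)))" .
qed

text \<open>For each label the error is the truncation error of \<open>f y\<close> tested on the
  loss difference. Treating the difference as a whole keeps its norm as a factor, which the
  Bernstein condition later makes small.\<close>

lemma cutoff_bias:
  assumes g: "g \<in> G" "g' \<in> G" and \<gamma>: "\<gamma> \<ge> 0" and L: "L \<ge> 0" and N: "N \<ge> 1"
  shows "\<bar>(risk loss P g - risk loss P g') - (\<integral>w. cut N g w - cut N g' w \<partial>Pt)\<bar>
    \<le> sqrt L * real N powr (- \<gamma>) * L2_norm X.\<nu>Y (\<lambda>w. loss_of loss g w - loss_of loss g' w)"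
proof -
  let ?l = "\<lambda>g y x. loss (g x) y"
  let ?h = "\<lambda>y x. loss (g x) y - loss (g' x) y"
  let ?T = "\<lambda>h y. \<Sum>k=1..N. L2_inner \<nu>\<^sub>X (f y) (\<phi> k) * L2_inner \<nu>\<^sub>X (\<phi> k) h"
  have h: "?h y \<in> L2 \<nu>\<^sub>X" if "y \<le> M" for y
    by (intro L2_diff loss_L2 g that)
  have inner: "L2_inner \<nu>\<^sub>X u (?l g y) - L2_inner \<nu>\<^sub>X u (?l g' y) = L2_inner \<nu>\<^sub>X u (?h y)"
    if "y \<le> M" "u \<in> L2 \<nu>\<^sub>X" for y u
    unfolding L2_inner_commute[of _ u]
    by (rule L2_inner_diff_left[symmetric]) (use that g loss_L2 in auto)
  have trunc: "?T (?l g y) y - ?T (?l g' y) y = ?T (?h y) y" if "y \<le> M" for y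
    unfolding sum_subtractf[symmetric] right_diff_distrib[symmetric]
    by (intro sum.cong refl arg_cong2[where f="(*)"] inner that \<phi>_L2) auto
  define R where "R = (risk loss P g - risk loss P g') - (\<integral>w. cut N g w - cut N g' w \<partial>Pt)"
  have "R = (\<Sum>y\<le>M. p y * (L2_inner \<nu>\<^sub>X (f y) (?l g y) - L2_inner \<nu>\<^sub>X (f y) (?l g' y)
          - (?T (?l g y) y - ?T (?l g' y) y)))"
    unfolding R_def Bochner_Integration.integral_diff[OF cut_mean(1) cut_mean(1)] cut_mean(2) risk_eq(2)[OF g(1)] risk_eq(2)[OF g(2)]
    by (simp add: sum_subtractf right_diff_distrib)
  also have "\<dots> = (\<Sum>y\<le>M. p y * (L2_inner \<nu>\<^sub>X (f y) (?h y) - ?T (?h y) y))"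
    by (intro sum.cong refl arg_cong2[where f="(*)"] arg_cong2[where f="(-)"] inner trunc f_L2) auto
  finally have "\<bar>R\<bar> \<le> (\<Sum>y\<le>M. \<bar>p y * (L2_inner \<nu>\<^sub>X (f y) (?h y) - ?T (?h y) y)\<bar>)"
    using sum_abs by simp
  also have "\<dots> \<le> (\<Sum>y\<le>M. p y * \<bar>L2_inner \<nu>\<^sub>X (f y) (?h y) - ?T (?h y) y\<bar>)"
  proof (rule sum_mono)
    fix y assume "y \<in> {..M}"
    then show "\<bar>p y * (L2_inner \<nu>\<^sub>X (f y) (?h y) - ?T (?h y) y)\<bar>
        \<le> p y * \<bar>L2_inner \<nu>\<^sub>X (f y) (?h y) - ?T (?h y) y\<bar>"
      using X.p_nonneg[of y] unfolding abs_mult by simp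
  qed
  also have "\<dots> \<le> (\<Sum>y\<le>M. p y * (sqrt L * real N powr (- \<gamma>) * L2_norm \<nu>\<^sub>X (?h y)))"
  proof (rule sum_mono, rule mult_left_mono)
    fix y assume "y \<in> {..M}"
    then have y: "y \<le> M" by simp
    have "f y \<in> ellipsoid \<nu>\<^sub>X \<phi> \<gamma> L" using f_regular[OF y] by (simp add: regular_densities_def)
    then show "\<bar>L2_inner \<nu>\<^sub>X (f y) (?h y) - ?T (?h y) y\<bar> \<le> sqrt L * real N powr (- \<gamma>) * L2_norm \<nu>\<^sub>X (?h y)"
      by (intro ellipsoid_truncation_error basis h y \<gamma> L N)
  qed (simp add: X.p_nonneg)
  also have "\<dots> = sqrt L * real N powr (- \<gamma>) * (\<Sum>y\<le>M. p y * L2_norm \<nu>\<^sub>X (?h y))"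
    by (simp add: sum_distrib_left mult_ac)
  also have "\<dots> \<le> sqrt L * real N powr (- \<gamma>) * L2_norm X.\<nu>Y (\<lambda>w. loss_of loss g w - loss_of loss g' w)"
  proof (intro mult_left_mono)
    show "(\<Sum>y\<le>M. p y * L2_norm \<nu>\<^sub>X (?h y)) \<le> L2_norm X.\<nu>Y (\<lambda>w. loss_of loss g w - loss_of loss g' w)"
      using X.L2_norm_labelled[of "\<lambda>w. loss_of loss g w - loss_of loss g' w"] h by (simp add: loss_of_def)
  qed (use L in simp)
  finally show ?thesis unfolding R_def .
qed

text \<open>For measurability, the increments are combinations of finitely many functions: each
  \<open>\<psi> k\<close> times a label indicator, and the label indicators themselves for the
  centring constant.\<close>

lemma centred_class_increments: "centred_class Pt (centred_increments Pt N \<delta>)"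
proof (intro centred_class.intro centred_class_axioms.intro)
  interpret prob_space Pt by (rule prob_space_Pt)
  show "prob_space Pt" by (rule prob_space_Pt)
  fix h assume "h \<in> centred_increments Pt N \<delta>"
  then obtain g g' where h: "h = (\<lambda>w. (cut N g w - cut N g' w) - (\<integral>w. cut N g w - cut N g' w \<partial>Pt))"
    unfolding centred_increments_def by auto
  have int: "integrable Pt (\<lambda>w. cut N g w - cut N g' w)"
    by (intro Bochner_Integration.integrable_diff cut_mean)
  show "integrable Pt h" unfolding h by (intro Bochner_Integration.integrable_diff int integrable_const)
  show "(\<integral>w. h w \<partial>Pt) = 0"
    unfolding h by (subst Bochner_Integration.integral_diff[OF int integrable_const])
      (simp add: prob_space del: Z.space_joint_law)
next
  fix I J :: "nat set" assume J: "finite J" "I \<subseteq> J"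
  \<comment> \<open>The index \<open>k = 0\<close> stands for the constant function: the label
    indicators sum to one on the sample space, so equal coefficients there represent the centring
    constant.\<close>
  define e :: "nat \<times> nat \<Rightarrow> 'b \<times> nat \<Rightarrow> real" where
    "e = (\<lambda>(k, y) (z, y'). (if k = 0 then 1 else \<psi> k z) * of_bool (y' = y))"
  show "sup_sum (centred_increments Pt N \<delta>) I \<in> borel_measurable (Pi\<^sub>M J (\<lambda>i. Pt))"
  proof (rule sup_sum_measurable_finite_dimensional[where e = e and F = "{..N} \<times> {..M}", OF _ _ _ J])
    fix i :: "nat \<times> nat"
    obtain k y where i: "i = (k, y)" by force
    have "(\<lambda>z. e i (z, y')) \<in> borel_measurable \<nu>\<^sub>Z" for y'
    proof (cases "k = 0")
      case False
      then have "\<psi> k \<in> borel_measurable \<nu>\<^sub>Z" using \<psi>_L2[of k] by (simp add: L2_def)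
      with False show ?thesis by (simp add: e_def i)
    qed (simp add: e_def i)
    then have "e i \<in> borel_measurable Z.\<nu>Y" by (rule Z.measurable_labelled)
    then show "e i \<in> borel_measurable Pt"
      by (simp cong: measurable_cong_sets add: Z.sets_joint_law)
  next
    fix h assume "h \<in> centred_increments Pt N \<delta>"
    then obtain g g' m where h: "h = (\<lambda>w. (cut N g w - cut N g' w) - m)"
      unfolding centred_increments_def by auto
    define c :: "nat \<times> nat \<Rightarrow> real" where
      "c = (\<lambda>(k, y). if k = 0 then - m else inverse (b k) *
        (L2_inner \<nu>\<^sub>X (\<phi> k) (\<lambda>x. loss (g x) y) - L2_inner \<nu>\<^sub>X (\<phi> k) (\<lambda>x. loss (g' x) y)))"
    have "h w = (\<Sum>i\<in>{..N} \<times> {..M}. c i * e i w)" if w: "w \<in> space Pt" for w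
    proof -
      obtain z y where zy: "w = (z, y)" "y \<le> M" using w by auto
      have "(\<Sum>i\<in>{..N} \<times> {..M}. c i * e i w)
          = (\<Sum>k\<le>N. \<Sum>y'\<le>M. if y = y' then c (k, y') * (if k = 0 then 1 else \<psi> k z) else 0)"
        unfolding sum.cartesian_product by (intro sum.cong refl) (auto simp: e_def zy)
      also have "\<dots> = (\<Sum>k\<le>N. c (k, y) * (if k = 0 then 1 else \<psi> k z))"
        using zy(2) by simp
      also have "\<dots> = - m + (\<Sum>k=1..N. c (k, y) * \<psi> k z)"
      proof -
        have "{..N} = insert 0 {1..N}" by auto
        then show ?thesis by (auto simp: c_def intro!: sum.cong)
      qed
      also have "(\<Sum>k=1..N. c (k, y) * \<psi> k z) = cut N g w - cut N g' w"
        unfolding zy cut_eq sum_subtractf[symmetric]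
        by (intro sum.cong refl) (auto simp: c_def algebra_simps)
      finally show ?thesis by (simp add: h)
    qed
    then show "\<exists>c. \<forall>w\<in>space Pt. h w = (\<Sum>i\<in>{..N} \<times> {..M}. c i * e i w)" by blast
  qed simp
qed

text \<open>The weak second moment bound in normalised form: a deviation \<open>u\<close> of the
  empirical mean is a sum of size \<open>n * u\<close>, and a modulus \<open>D / sqrt m\<close>
  means \<open>D * sqrt m\<close> for the sum.\<close>

lemma modulus_tail:
  fixes D u :: real
  assumes n: "n > 0" and D: "D \<ge> 0" and u: "u > 0"
    and modulus: "\<And>m. m > 0 \<Longrightarrow>
      expected_modulus Pt m X.\<nu>Y G (loss_of loss) (cut N) \<delta> \<le> ennreal (D / sqrt m)"
  defines "F \<equiv> {s \<in> space (\<Pi>\<^sub>M i\<in>{..<n}. Pt).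
      ennreal (n * u) < sup_sum (centred_increments Pt N \<delta>) {..<n} s}"
  shows "F \<in> sets (\<Pi>\<^sub>M i\<in>{..<n}. Pt)" "measure (\<Pi>\<^sub>M i\<in>{..<n}. Pt) F \<le> 32 * D\<^sup>2 / (n * u\<^sup>2)"
proof -
  interpret centred_class Pt "centred_increments Pt N \<delta>" by (rule centred_class_increments)
  have meas[measurable]: "sup_sum (centred_increments Pt N \<delta>) {..<m} \<in> borel_measurable (\<Pi>\<^sub>M i\<in>{..<m}. Pt)" for m
    by (rule sup_sum_measurable) auto
  show "F \<in> sets (\<Pi>\<^sub>M i\<in>{..<n}. Pt)" unfolding F_def by measurable
  have "(\<integral>\<^sup>+s. sup_sum (centred_increments Pt N \<delta>) {..<m} s \<partial>(\<Pi>\<^sub>M i\<in>{..<m}. Pt)) \<le> ennreal (D * sqrt m)"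
    (is "?I \<le> _") if m: "m > 0" for m
  proof -
    have "expected_modulus Pt m X.\<nu>Y G (loss_of loss) (cut N) \<delta> = ennreal (1 / m) * ?I"
      unfolding expected_modulus_def sup_sum_centred_increments[OF m] by (rule nn_integral_cmult[OF meas])
    then have "ennreal (1 / m) * ?I \<le> ennreal (D / sqrt m)" using modulus[OF m] by simp
    then have "ennreal m * (ennreal (1 / m) * ?I) \<le> ennreal m * ennreal (D / sqrt m)"
      by (rule mult_left_mono) simp
    also have "ennreal m * ennreal (D / sqrt m) = ennreal (D * sqrt m)"
      using m D by (simp add: ennreal_mult[symmetric] real_div_sqrt field_simps)
    also have "ennreal m * (ennreal (1 / m) * ?I) = ?I"
      using m by (simp add: mult.assoc[symmetric] ennreal_mult[symmetric])
    finally show ?thesis .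
  qed
  then have "measure (\<Pi>\<^sub>M i\<in>{..<n}. Pt) F \<le> 32 * D\<^sup>2 * n / (n * u)\<^sup>2"
    unfolding F_def using n u D by (intro weak_moment_bound) auto
  also have "\<dots> = 32 * D\<^sup>2 / (n * u\<^sup>2)"
    using n u by (simp add: field_simps power2_eq_square)
  finally show "measure (\<Pi>\<^sub>M i\<in>{..<n}. Pt) F \<le> 32 * D\<^sup>2 / (n * u\<^sup>2)" .
qed

end

end

section \<open>Excess risk of the empirical minimizer\<close>

context spectral_cutoff
begin

text \<open>\<open>K \<ge> 1 / 4\<close> keeps the radii \<open>\<delta> s\<close> of the proof positive when \<open>\<kappa>\<^sub>0 = 0\<close>, and
  \<open>sqrt K\<close> is still an admissible radius.\<close>

lemma excess_risk_bound:
  fixes f :: "nat \<Rightarrow> 'a \<Rightarrow> real" and gstar :: "'a \<Rightarrow> real"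
    and ghat :: "(nat \<Rightarrow> 'b \<times> nat) \<Rightarrow> 'a \<Rightarrow> real"
    and \<beta> \<gamma> L \<kappa> \<kappa>\<^sub>0 K \<rho> C1 c s0 :: real and n N :: nat
  defines "PX \<equiv> joint_law \<nu>\<^sub>X M p f" and "PZ \<equiv> joint_law \<nu>\<^sub>Z M p (\<lambda>y. A (f y))"
  assumes f: "\<And>y. y \<le> M \<Longrightarrow> f y \<in> regular_densities \<nu>\<^sub>X \<phi> \<gamma> L"
      "\<And>y. y \<le> M \<Longrightarrow> prob_density \<nu>\<^sub>Z (A (f y))"
    and gstar: "is_arg_min (risk loss PX) (\<lambda>g. g \<in> G) gstar"
    and bernstein: "bernstein_class PX X.\<nu>Y \<kappa> \<kappa>\<^sub>0
        {\<lambda>w. loss_of loss g w - loss_of loss gstar w | g. g \<in> G}"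
    and modulus: "\<And>m \<delta>. m > 0 \<Longrightarrow> 0 < \<delta> \<Longrightarrow> \<delta> < 1 \<or> \<delta> \<le> sqrt \<kappa>\<^sub>0 \<Longrightarrow>
        expected_modulus PZ m X.\<nu>Y G (loss_of loss) (cut N) \<delta>
        \<le> ennreal (C1 * (real N powr \<beta> / sqrt (real m)) * \<delta> powr (1 - \<rho>))"
    and params: "\<gamma> > 0" "L > 0" "\<kappa> \<ge> 1" "0 < \<rho>" "\<rho> < 1" "C1 > 0"
    and K: "K = max \<kappa>\<^sub>0 (1 / 4)"
    and n: "n > 0" and N: "N > 0"
    and ghat: "\<And>s. s \<in> space (\<Pi>\<^sub>M i\<in>{..<n}. PZ) \<Longrightarrow>
        is_arg_min (\<lambda>g. emp_mean n s (cut N g)) (\<lambda>g. g \<in> G) (ghat s)"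
    and ghat_meas: "(\<lambda>s. risk loss PX (ghat s)) \<in> borel_measurable (\<Pi>\<^sub>M i\<in>{..<n}. PZ)"
    and s0: "s0 > 0"
    and bias: "2 * (sqrt L * real N powr (- \<gamma>) * sqrt K) \<le> s0 powr ((2 * \<kappa> - 1) / (2 * \<kappa>))"
    and noise: "C1\<^sup>2 * (real N powr (2 * \<beta>) / n) \<le> c * s0 powr ((2 * \<kappa> - 1 + \<rho>) / \<kappa>)"
  shows "(\<integral>s. risk loss PX (ghat s) \<partial>(\<Pi>\<^sub>M i\<in>{..<n}. PZ)) - risk loss PX gstar
    \<le> (1 + 2 * (128 * K powr (1 - \<rho>) * 2 powr ((1 - \<rho>) / \<kappa>) * c)
          / (1 - 2 powr (- ((\<kappa> - 1 + \<rho>) / \<kappa>)))) * s0"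
proof -
  let ?\<Omega> = "\<Pi>\<^sub>M i\<in>{..<n}. PZ"
  interpret PZ: prob_space PZ unfolding PZ_def by (rule prob_space_Pt[of f \<gamma> L, OF f])
  interpret \<Omega>: prob_space ?\<Omega> by (intro prob_space_PiM PZ.prob_space_axioms)
  define r where "r s = risk loss PX (ghat s) - risk loss PX gstar" for s
  \<comment> \<open>This is the Bernstein radius at excess risk \<open>2 * s\<close>, the top of a
    shell. Excess risks never exceed one, and the \<open>min\<close> keeps the radius at most
    \<open>sqrt K\<close>.\<close>
  define \<delta> where "\<delta> s = sqrt K * min 1 (2 * s) powr (1 / (2 * \<kappa>))" for s
  \<comment> \<open>Half of the excess risk is reserved for the bias, so the noise has to exceed
    \<open>s / 2\<close>.\<close>
  define F where "F s = {\<omega> \<in> space ?\<Omega>.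
      ennreal (n * (s / 2)) < sup_sum (centred_increments PZ N (\<delta> s)) {..<n} \<omega>}" for s
  define D where "D s = C1 * real N powr \<beta> * \<delta> s powr (1 - \<rho>)" for s
  have Kpos: "K > 0" "\<kappa>\<^sub>0 \<le> K" using K by auto
  have gstar_G: "gstar \<in> G" using gstar by (simp add: is_arg_min_def)
  have gstar_le: "risk loss PX gstar \<le> risk loss PX g" if "g \<in> G" for g
    using gstar that by (auto simp: is_arg_min_def not_less)
  have ghat_G: "ghat \<omega> \<in> G" if "\<omega> \<in> space ?\<Omega>" for \<omega>
    using ghat[OF that] by (simp add: is_arg_min_def)
  have r01: "0 \<le> r \<omega> \<and> r \<omega> \<le> 1" if "\<omega> \<in> space ?\<Omega>" for \<omega>
    using gstar_le[OF ghat_G[OF that]] risk_01[of f \<gamma> L, OF f ghat_G[OF that]] risk_01[of f \<gamma> L, OF f gstar_G]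
    unfolding r_def PX_def by simp
  have r_meas: "r \<in> borel_measurable ?\<Omega>"
    unfolding r_def using ghat_meas by (intro borel_measurable_diff borel_measurable_const)
  have \<delta>_pos: "\<delta> s > 0" if "s > 0" for s
    using that Kpos by (simp add: \<delta>_def)
  \<comment> \<open>The radius is at most \<open>sqrt K\<close>, which is
    \<open>sqrt \<kappa>\<^sub>0\<close> or \<open>1 / 2\<close> according to the term attaining the
    maximum in \<open>K\<close>; both are admissible.\<close>
  have \<delta>_adm: "\<delta> s < 1 \<or> \<delta> s \<le> sqrt \<kappa>\<^sub>0" if "s > 0" for s
  proof -
    have "min 1 (2 * s) powr (1 / (2 * \<kappa>)) \<le> 1 powr (1 / (2 * \<kappa>))"
      using that params by (intro powr_mono2) auto
    then have le: "\<delta> s \<le> sqrt K"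
      using Kpos unfolding \<delta>_def by (intro mult_left_le) auto
    show ?thesis
    proof (cases "K = \<kappa>\<^sub>0")
      case False
      then have "K = (1 / 2)\<^sup>2" using K by (auto simp: max_def power2_eq_square split: if_splits)
      then have "sqrt K = 1 / 2" by (simp only: real_sqrt_abs)
      then show ?thesis using le by simp
    qed (use le in simp)
  qed
  \<comment> \<open>The Bernstein condition read at the empirical minimizer: the mean loss
    difference under \<open>PX\<close> is exactly \<open>r \<omega>\<close>.\<close>
  have distance: "L2_norm X.\<nu>Y (\<lambda>w. loss_of loss (ghat \<omega>) w - loss_of loss gstar w)
      \<le> sqrt K * r \<omega> powr (1 / (2 * \<kappa>))" (is "?d \<le> _") if \<omega>: "\<omega> \<in> space ?\<Omega>" for \<omega>
  proof -
    have "(\<integral>w. loss_of loss (ghat \<omega>) w - loss_of loss gstar w \<partial>PX) = r \<omega>"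
      unfolding r_def risk_def PX_def
      by (rule Bochner_Integration.integral_diff[OF risk_eq(1)[of f \<gamma> L, OF f ghat_G[OF \<omega>]] risk_eq(1)[of f \<gamma> L, OF f gstar_G]])
    then have "?d\<^sup>2 \<le> \<kappa>\<^sub>0 * r \<omega> powr (1 / \<kappa>)"
      using bernstein ghat_G[OF \<omega>] unfolding bernstein_class_def by fastforce
    also have "\<dots> \<le> K * r \<omega> powr (1 / \<kappa>)" using Kpos by (intro mult_right_mono) auto
    also have "\<dots> = (sqrt K * r \<omega> powr (1 / (2 * \<kappa>)))\<^sup>2"
    proof -
      have "(r \<omega> powr (1 / (2 * \<kappa>)))\<^sup>2 = r \<omega> powr (1 / \<kappa>)"
        by (simp add: power2_eq_square powr_add[symmetric])
      then show ?thesis using Kpos by (simp add: power_mult_distrib)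
    qed
    finally show ?thesis
      using Kpos by (intro power2_le_imp_le[OF _ mult_nonneg_nonneg]) auto
  qed
  \<comment> \<open>Minimality makes the empirical mean of \<open>?T\<close> nonpositive, while its
    true mean is at least half the excess risk. Their gap exceeds \<open>s / 2\<close>, although
    \<open>ghat \<omega>\<close> lies within radius \<open>\<delta> s\<close> of
    \<open>gstar\<close>.\<close>
  have shell: "\<omega> \<in> F s" if s: "s0 \<le> s" and \<omega>: "\<omega> \<in> space ?\<Omega>" and lo: "s < r \<omega>" and hi: "r \<omega> \<le> 2 * s" for s \<omega>
  proof -
    let ?g = "ghat \<omega>"
    let ?T = "\<lambda>w. cut N ?g w - cut N gstar w"
    let ?d = "L2_norm X.\<nu>Y (\<lambda>w. loss_of loss ?g w - loss_of loss gstar w)"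
    have r_pos: "r \<omega> > 0" using s s0 lo by linarith
    have d_le: "?d \<le> sqrt K * r \<omega> powr (1 / (2 * \<kappa>))" by (rule distance[OF \<omega>])
    also have "\<dots> \<le> \<delta> s"
      unfolding \<delta>_def using hi r01[OF \<omega>] params Kpos by (intro mult_left_mono powr_mono2) auto
    finally have d\<delta>: "?d \<le> \<delta> s" .
    have "\<bar>r \<omega> - (\<integral>w. ?T w \<partial>PZ)\<bar> \<le> sqrt L * real N powr (- \<gamma>) * ?d"
      unfolding r_def PX_def PZ_def
      by (rule cutoff_bias[of f \<gamma> L, OF f ghat_G[OF \<omega>] gstar_G]) (use params N in auto)
    also have "\<dots> \<le> sqrt L * real N powr (- \<gamma>) * (sqrt K * r \<omega> powr (1 / (2 * \<kappa>)))"
      using params by (intro mult_left_mono d_le) auto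
    also have "\<dots> \<le> r \<omega> / 2"
    proof -
      \<comment> \<open>The assumption \<open>bias\<close> at level \<open>s0\<close> persists at
        the larger level \<open>r \<omega>\<close>; multiplying by
        \<open>r \<omega> powr (1 / (2 * \<kappa>))\<close> completes the exponent to one.\<close>
      have "2 * (sqrt L * real N powr (- \<gamma>) * sqrt K) \<le> r \<omega> powr ((2 * \<kappa> - 1) / (2 * \<kappa>))"
        using bias s s0 lo params
        by (intro order_trans[OF bias] powr_mono2) auto
      then have "2 * (sqrt L * real N powr (- \<gamma>) * sqrt K) * r \<omega> powr (1 / (2 * \<kappa>))
          \<le> r \<omega> powr ((2 * \<kappa> - 1) / (2 * \<kappa>)) * r \<omega> powr (1 / (2 * \<kappa>))"
        by (rule mult_right_mono) simp
      also have "\<dots> = r \<omega> powr ((2 * \<kappa> - 1) / (2 * \<kappa>) + 1 / (2 * \<kappa>))"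
        by (simp add: powr_add)
      also have "(2 * \<kappa> - 1) / (2 * \<kappa>) + 1 / (2 * \<kappa>) = 1" using params by (simp add: field_simps)
      finally show ?thesis using r_pos by (simp add: mult_ac)
    qed
    finally have "r \<omega> / 2 \<le> (\<integral>w. ?T w \<partial>PZ)" by linarith
    moreover have "emp_mean n \<omega> ?T \<le> 0"
    proof -
      have "emp_mean n \<omega> (cut N ?g) \<le> emp_mean n \<omega> (cut N gstar)"
        using ghat[OF \<omega>] gstar_G by (auto simp: is_arg_min_def not_less)
      moreover have "emp_mean n \<omega> ?T = emp_mean n \<omega> (cut N ?g) - emp_mean n \<omega> (cut N gstar)"
        by (simp add: emp_mean_def sum_subtractf diff_divide_distrib)
      ultimately show ?thesis by simp
    qed
    ultimately have "s / 2 < (\<integral>w. ?T w \<partial>PZ) - emp_mean n \<omega> ?T" using lo by linarith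
    also have "\<dots> = - (\<Sum>i<n. ?T (\<omega> i) - (\<integral>w. ?T w \<partial>PZ)) / n"
    proof -
      have "u - emp_mean n \<omega> T = - (\<Sum>i<n. T (\<omega> i) - u) / n" for u and T :: "'b \<times> nat \<Rightarrow> real"
        using n by (simp add: emp_mean_def sum_subtractf field_simps)
      then show ?thesis .
    qed
    finally have "(s / 2) * n < - (\<Sum>i<n. ?T (\<omega> i) - (\<integral>w. ?T w \<partial>PZ))"
      by (rule pos_less_divide_eq[THEN iffD1, rotated]) (use n in simp)
    also have "\<dots> \<le> \<bar>\<Sum>i<n. ?T (\<omega> i) - (\<integral>w. ?T w \<partial>PZ)\<bar>"
      by (rule abs_ge_minus_self)
    finally have "n * (s / 2) < \<bar>\<Sum>i<n. ?T (\<omega> i) - (\<integral>w. ?T w \<partial>PZ)\<bar>"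
      by (simp only: mult.commute)
    then have "ennreal (n * (s / 2)) < ennreal \<bar>\<Sum>i<n. ?T (\<omega> i) - (\<integral>w. ?T w \<partial>PZ)\<bar>"
      by (subst ennreal_less_iff) (use s s0 in simp)
    also have "\<dots> \<le> sup_sum (centred_increments PZ N (\<delta> s)) {..<n} \<omega>"
      unfolding sup_sum_def
      by (rule SUP_upper2[of "\<lambda>w. ?T w - (\<integral>w. ?T w \<partial>PZ)"])
        (use d\<delta> ghat_G[OF \<omega>] gstar_G in \<open>auto simp: centred_increments_def intro!: image_eqI[of _ _ "(?g, gstar)"]\<close>)
    finally show ?thesis using \<omega> by (simp add: F_def)
  qed
  have tail: "F s \<in> sets ?\<Omega>" "measure ?\<Omega> (F s) \<le> 32 * (D s)\<^sup>2 / (n * (s / 2)\<^sup>2)" if s: "s0 \<le> s" for s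
  proof -
    have spos: "s > 0" using s s0 by linarith
    have D: "D s \<ge> 0" using params by (simp add: D_def)
    have "expected_modulus PZ m X.\<nu>Y G (loss_of loss) (cut N) (\<delta> s) \<le> ennreal (D s / sqrt m)" if "m > 0" for m
      using modulus[OF that \<delta>_pos[OF spos] \<delta>_adm[OF spos]] by (simp add: D_def mult_ac)
    then have "expected_modulus (joint_law \<nu>\<^sub>Z M p (\<lambda>y. A (f y))) m X.\<nu>Y G (loss_of loss) (cut N) (\<delta> s)
        \<le> ennreal (D s / sqrt m)" if "m > 0" for m
      using that unfolding PZ_def .
    note * = modulus_tail[where f = f and \<gamma> = \<gamma> and L = L and D = "D s" and u = "s / 2" and N = N
        and \<delta> = "\<delta> s", OF f n D half_gt_zero[OF spos] this]
    show "F s \<in> sets ?\<Omega>" unfolding F_def PZ_def by (rule *(1))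
    show "measure ?\<Omega> (F s) \<le> 32 * (D s)\<^sup>2 / (n * (s / 2)\<^sup>2)"
      unfolding F_def PZ_def by (rule *(2))
  qed
  let ?K = "128 * K powr (1 - \<rho>) * 2 powr ((1 - \<rho>) / \<kappa>) * c"
  let ?e = "(2 * \<kappa> - 1 + \<rho>) / \<kappa>"
  \<comment> \<open>The sign of \<open>c\<close> is forced by \<open>noise\<close>; it makes the
    peeling constant nonnegative.\<close>
  have c: "c \<ge> 0"
  proof -
    have "0 \<le> C1\<^sup>2 * (real N powr (2 * \<beta>) / n)" by simp
    then have "0 \<le> c * s0 powr ?e" using noise by linarith
    then show ?thesis using s0 by (simp add: zero_le_mult_iff)
  qed
  \<comment> \<open>The squared radius contributes \<open>s powr ((1 - \<rho>) / \<kappa>)\<close>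
    and the squared threshold \<open>s powr (- 2)\<close>, together \<open>s powr (- ?e)\<close>.
    The excess of \<open>?e\<close> over one is positive, as peeling requires. The factor 128 is 32
    times 4, from the threshold \<open>s / 2\<close>.\<close>
  have prob_F: "measure ?\<Omega> (F s) \<le> ?K * (s0 / s) powr (1 + (\<kappa> - 1 + \<rho>) / \<kappa>)" if s: "s0 \<le> s" for s
  proof -
    have spos: "s > 0" using s s0 by linarith
    have e: "1 + (\<kappa> - 1 + \<rho>) / \<kappa> = ?e" "(1 - \<rho>) / \<kappa> - 2 = - ?e"
      using params by (simp_all add: field_simps)
    have "(\<delta> s powr (1 - \<rho>))\<^sup>2 \<le> K powr (1 - \<rho>) * (2 * s) powr ((1 - \<rho>) / \<kappa>)"
    proof -
      have "(\<delta> s powr (1 - \<rho>))\<^sup>2 = ((\<delta> s)\<^sup>2) powr (1 - \<rho>)"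
        using \<delta>_pos[OF spos] by (simp add: power2_eq_square powr_mult)
      also have "(\<delta> s)\<^sup>2 = K * min 1 (2 * s) powr (1 / \<kappa>)"
      proof -
        have "(min 1 (2 * s) powr (1 / (2 * \<kappa>)))\<^sup>2 = min 1 (2 * s) powr (1 / \<kappa>)"
          by (simp add: power2_eq_square powr_add[symmetric])
        then show ?thesis using Kpos by (simp add: \<delta>_def power_mult_distrib)
      qed
      also have "(K * min 1 (2 * s) powr (1 / \<kappa>)) powr (1 - \<rho>)
          \<le> (K * (2 * s) powr (1 / \<kappa>)) powr (1 - \<rho>)"
        using spos params Kpos by (intro powr_mono2 mult_left_mono) auto
      also have "\<dots> = K powr (1 - \<rho>) * (2 * s) powr ((1 - \<rho>) / \<kappa>)"
        using Kpos spos by (simp add: powr_mult powr_powr)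
      finally show ?thesis .
    qed
    note \<delta>_le = this
    have "(D s)\<^sup>2 / n = C1\<^sup>2 * (real N powr (2 * \<beta>) / n) * (\<delta> s powr (1 - \<rho>))\<^sup>2"
    proof -
      have "(real N powr \<beta>)\<^sup>2 = real N powr (2 * \<beta>)" by (simp add: power2_eq_square powr_add[symmetric])
      then show ?thesis by (simp add: D_def power_mult_distrib)
    qed
    also have "\<dots> \<le> (c * s0 powr ?e) * (K powr (1 - \<rho>) * (2 * s) powr ((1 - \<rho>) / \<kappa>))"
      using c by (intro mult_mono noise \<delta>_le) auto
    finally have "(D s)\<^sup>2 / n \<le> (c * s0 powr ?e) * (K powr (1 - \<rho>) * (2 * s) powr ((1 - \<rho>) / \<kappa>))" .
    then have "128 * ((D s)\<^sup>2 / n) / s\<^sup>2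
        \<le> 128 * ((c * s0 powr ?e) * (K powr (1 - \<rho>) * (2 * s) powr ((1 - \<rho>) / \<kappa>))) / s\<^sup>2"
      by (intro divide_right_mono mult_left_mono) auto
    also have "\<dots> = ?K * s0 powr ?e * (s powr ((1 - \<rho>) / \<kappa>) / s\<^sup>2)"
      using spos by (simp add: powr_mult)
    also have "s powr ((1 - \<rho>) / \<kappa>) / s\<^sup>2 = s powr (- ?e)"
      unfolding e(2)[symmetric] using spos by (simp add: powr_diff)
    also have "?K * s0 powr ?e * s powr (- ?e) = ?K * (s0 / s) powr ?e"
    proof -
      have "(s0 / s) powr x = s0 powr x * s powr (- x)" for x
        using spos s0 by (simp add: powr_divide powr_minus_divide)
      then show ?thesis by (simp only: mult.assoc)
    qed
    finally have "128 * ((D s)\<^sup>2 / n) / s\<^sup>2 \<le> ?K * (s0 / s) powr ?e" .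
    moreover have "32 * (D s)\<^sup>2 / (n * (s / 2)\<^sup>2) = 128 * ((D s)\<^sup>2 / n) / s\<^sup>2"
      by (simp add: power_divide)
    ultimately show ?thesis using tail(2)[OF s] unfolding e(1) by linarith
  qed
  have "\<Omega>.expectation r \<le> (1 + 2 * ?K / (1 - 2 powr (- ((\<kappa> - 1 + \<rho>) / \<kappa>)))) * s0"
    by (rule \<Omega>.expectation_le_by_peeling[OF r_meas r01 s0 _ _ tail(1) prob_F shell])
      (use c params in auto)
  moreover have "\<Omega>.expectation r = (\<integral>s. risk loss PX (ghat s) \<partial>?\<Omega>) - risk loss PX gstar"
  proof -
    have "integrable ?\<Omega> (\<lambda>s. risk loss PX (ghat s))"
      by (rule \<Omega>.integrable_const_bound[of _ 1])
        (use risk_01[of f \<gamma> L, OF f ghat_G] ghat_meas in \<open>auto simp: PX_def\<close>)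
    then show ?thesis unfolding r_def by (simp add: \<Omega>.prob_space)
  qed
  ultimately show ?thesis by simp
qed

end

section \<open>The uniform rate for the prescribed cut-off\<close>

theorem theorem3:
  fixes \<nu> \<nu>\<^sub>X \<nu>\<^sub>Z :: "(real ^ 'd) measure"
    and X Xt :: "(real ^ 'd) set"
    and M :: nat
    and p :: "nat \<Rightarrow> real"
    and A A' :: "(real ^ 'd \<Rightarrow> real) \<Rightarrow> (real ^ 'd \<Rightarrow> real)"
    and b :: "nat \<Rightarrow> real"
    and \<phi> \<psi> :: "nat \<Rightarrow> real ^ 'd \<Rightarrow> real"
    and G :: "(real ^ 'd \<Rightarrow> real) set"
    and loss :: "real \<Rightarrow> nat \<Rightarrow> real"
    and \<beta> \<gamma> L \<kappa> \<kappa>\<^sub>0 \<rho> C1 :: real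
    and \<nu>Y :: "((real ^ 'd) \<times> nat) measure"
    and P Pt :: "(nat \<Rightarrow> real ^ 'd \<Rightarrow> real) \<Rightarrow> ((real ^ 'd) \<times> nat) measure"
    and cut :: "nat \<Rightarrow> (real ^ 'd \<Rightarrow> real) \<Rightarrow> (real ^ 'd) \<times> nat \<Rightarrow> real"
    and gstar :: "(nat \<Rightarrow> real ^ 'd \<Rightarrow> real) \<Rightarrow> (real ^ 'd \<Rightarrow> real)"
    and D :: "(nat \<Rightarrow> real ^ 'd \<Rightarrow> real) set"
    and N :: "nat \<Rightarrow> nat"
    and ghat :: "nat \<Rightarrow> (nat \<Rightarrow> (real ^ 'd) \<times> nat) \<Rightarrow> (real ^ 'd \<Rightarrow> real)"
  assumes \<nu>: "sigma_finite_measure \<nu>" "sets \<nu> = sets borel"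
    and X: "X \<in> sets \<nu>" "Xt \<in> sets \<nu>"
    and \<nu>X_def: "\<nu>\<^sub>X = restrict_space \<nu> X"
    and \<nu>Z_def: "\<nu>\<^sub>Z = restrict_space \<nu> Xt"
    and M: "M \<ge> 1"
    and p: "\<And>y. y \<le> M \<Longrightarrow> 0 \<le> p y" "(\<Sum>y\<le>M. p y) = 1"
    and \<nu>Y_def: "\<nu>Y = \<nu>\<^sub>X \<Otimes>\<^sub>M label_law M p"
    and P_def: "\<And>f. P f = joint_law \<nu>\<^sub>X M p f"
    and Pt_def: "\<And>f. Pt f = joint_law \<nu>\<^sub>Z M p (\<lambda>y. A (f y))"
    and A: "L2_linear \<nu>\<^sub>X \<nu>\<^sub>Z A" "L2_compact \<nu>\<^sub>X \<nu>\<^sub>Z A" "L2_adjoint \<nu>\<^sub>X \<nu>\<^sub>Z A A'"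
    and svd: "singular_value_decomposition \<nu>\<^sub>X \<nu>\<^sub>Z A A' b \<phi> \<psi>"
    and \<beta>: "\<beta> \<ge> 0" "b \<sim>[at_top] (\<lambda>k. real k powr (- \<beta>))"
    and G: "G \<subseteq> borel_measurable \<nu>\<^sub>X"
    and loss01: "\<And>t y. y \<le> M \<Longrightarrow> 0 \<le> loss t y \<and> loss t y \<le> 1"
    and loss_L2: "\<And>g y. g \<in> G \<Longrightarrow> y \<le> M \<Longrightarrow> (\<lambda>x. loss (g x) y) \<in> L2 \<nu>\<^sub>X"
    and cut_def: "\<And>m. cut m = cutoff_loss \<nu>\<^sub>X b \<phi> \<psi> loss m"
    and params: "\<gamma> > 0" "L > 0" "\<kappa> \<ge> 1" "\<kappa>\<^sub>0 \<ge> 0" "0 < \<rho>" "\<rho> < 1" "C1 > 0"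
    and D_def: "D = {f.
          (\<forall>y\<le>M. f y \<in> regular_densities \<nu>\<^sub>X \<phi> \<gamma> L \<and> prob_density \<nu>\<^sub>Z (A (f y))) \<and>
          is_arg_min (risk loss (P f)) (\<lambda>g. g \<in> G) (gstar f) \<and>
          bernstein_class (P f) \<nu>Y \<kappa> \<kappa>\<^sub>0
            {\<lambda>w. loss_of loss g w - loss_of loss (gstar f) w | g. g \<in> G} \<and>
          (\<forall>n\<ge>1. \<forall>m\<ge>1. \<forall>\<delta>. 0 < \<delta> \<and> (\<delta> < 1 \<or> \<delta> \<le> sqrt \<kappa>\<^sub>0) \<longrightarrow>
             expected_modulus (Pt f) n \<nu>Y G (loss_of loss) (cut m) \<delta>
             \<le> ennreal (C1 * (real m powr \<beta> / sqrt (real n)) * \<delta> powr (1 - \<rho>)))}"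
    and N: "\<And>n. n \<ge> 1 \<Longrightarrow>
          (let t = real n powr ((2 * \<kappa> - 1) / (2 * \<gamma> * (2 * \<kappa> + \<rho> - 1) + 2 * (2 * \<kappa> - 1) * \<beta>))
           in N n = nat \<lfloor>t\<rfloor> \<or> N n = nat \<lceil>t\<rceil>)"
    and ghat: "\<And>n s. n \<ge> 1 \<Longrightarrow> s \<in> {..<n} \<rightarrow>\<^sub>E Xt \<times> {..M} \<Longrightarrow>
          is_arg_min (\<lambda>g. emp_mean n s (cut (N n) g)) (\<lambda>g. g \<in> G) (ghat n s)"
    and ghat_meas: "\<And>n f. n \<ge> 1 \<Longrightarrow> f \<in> D \<Longrightarrow>
          (\<lambda>s. risk loss (P f) (ghat n s)) \<in> borel_measurable (\<Pi>\<^sub>M i\<in>{..<n}. Pt f)"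
  shows "\<exists>C>0. \<forall>\<^sub>F n in sequentially.
           (\<Squnion>f\<in>D. ereal ((\<integral>s. risk loss (P f) (ghat n s) \<partial>(\<Pi>\<^sub>M i\<in>{..<n}. Pt f))
                           - risk loss (P f) (gstar f)))
           \<le> ereal (C * real n powr
               (- (\<kappa> * \<gamma> / (\<gamma> * (2 * \<kappa> + \<rho> - 1) + (2 * \<kappa> - 1) * \<beta>))))"
proof -
  have space_\<nu>: "space \<nu> = UNIV" using sets_eq_imp_space_eq[OF \<nu>(2)] by simp
  have space_\<nu>Z: "space \<nu>\<^sub>Z = Xt" by (simp add: \<nu>Z_def space_restrict_space space_\<nu>)
  have "sigma_finite_measure \<nu>\<^sub>X" "sigma_finite_measure \<nu>\<^sub>Z"
    unfolding \<nu>X_def \<nu>Z_def by (intro sigma_finite_measure_restrict_space \<nu> X)+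
  then interpret spectral_cutoff \<nu>\<^sub>X \<nu>\<^sub>Z M p A A' b \<phi> \<psi> loss G
    by (intro spectral_cutoff.intro spectral_cutoff_axioms.intro labelled_measure.intro
        labelled_measure_axioms.intro p A svd loss01 loss_L2)
  \<comment> \<open>\<open>x\<close> and \<open>e\<close> are the exponents of bias and noise in
    terms of the target rate.\<close>
  define x where "x = (2 * \<kappa> - 1) / (2 * \<kappa>)"
  define e where "e = (2 * \<kappa> - 1 + \<rho>) / \<kappa>"
  define K where "K = max \<kappa>\<^sub>0 (1 / 4)"
  \<comment> \<open>The factor \<open>2 powr \<gamma>\<close> pays for \<open>N n\<close> being as
    small as half the unrounded cut-off.\<close>
  define B where "B = 2 * sqrt L * sqrt K * 2 powr \<gamma>"
  \<comment> \<open>Peeling starts at \<open>c0\<close> times the target rate: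
    \<open>c0 powr x \<ge> B\<close> absorbs the constant of the bias, and \<open>c0 \<ge> 1\<close>
    preserves the noise bound.\<close>
  define c0 where "c0 = max 1 (B powr (1 / x))"
  \<comment> \<open>The factor \<open>4 powr \<beta>\<close> pays for \<open>N n\<close> being as
    large as twice the unrounded cut-off.\<close>
  define c where "c = C1\<^sup>2 * 4 powr \<beta>"
  \<comment> \<open>Only fixed parameters enter, so the constant is uniform in \<open>n\<close> and
    \<open>f\<close> and the supremum over \<open>D\<close> can be bounded memberwise.\<close>
  define C where "C = (1 + 2 * (128 * K powr (1 - \<rho>) * 2 powr ((1 - \<rho>) / \<kappa>) * c)
      / (1 - 2 powr (- ((\<kappa> - 1 + \<rho>) / \<kappa>)))) * c0"
  have x: "x > 0" and e: "e > 0" using params by (simp_all add: x_def e_def)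
  have Kpos: "K > 0" by (simp add: K_def)
  have c0: "c0 \<ge> 1" "B \<le> c0 powr x"
  proof -
    show "c0 \<ge> 1" by (simp add: c0_def)
    have "B = (B powr (1 / x)) powr x"
      using x params Kpos by (simp add: powr_powr B_def)
    also have "\<dots> \<le> c0 powr x" using x by (intro powr_mono2) (auto simp: c0_def)
    finally show "B \<le> c0 powr x" .
  qed
  have "2 powr (- ((\<kappa> - 1 + \<rho>) / \<kappa>)) < (1::real)" using params by (intro powr_less_one) auto
  then have C: "C > 0"
    unfolding C_def c_def using c0(1) by (intro mult_pos_pos add_pos_nonneg divide_nonneg_pos) auto
  \<comment> \<open>The estimate is obtained from \<open>n = 1\<close> on, so the rate holds in
    particular for all large \<open>n\<close>.\<close>
  have bound: "(\<integral>s. risk loss (P f) (ghat n s) \<partial>(\<Pi>\<^sub>M i\<in>{..<n}. Pt f)) - risk loss (P f) (gstar f)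
      \<le> C * real n powr (- (\<kappa> * \<gamma> / (\<gamma> * (2 * \<kappa> + \<rho> - 1) + (2 * \<kappa> - 1) * \<beta>)))"
    if n: "n \<ge> 1" and f: "f \<in> D" for n f
  proof -
    define t where "t = real n powr ((2 * \<kappa> - 1) / (2 * \<gamma> * (2 * \<kappa> + \<rho> - 1) + 2 * (2 * \<kappa> - 1) * \<beta>))"
    define s where "s = real n powr (- (\<kappa> * \<gamma> / (\<gamma> * (2 * \<kappa> + \<rho> - 1) + (2 * \<kappa> - 1) * \<beta>)))"
    have s: "s > 0" using n by (simp add: s_def)
    have ts: "t powr (- \<gamma>) = s powr x" "t powr (2 * \<beta>) / n = s powr e"
      unfolding t_def s_def x_def e_def using rate_exponents[of "real n" \<gamma> \<kappa> \<rho> \<beta>] n params \<beta>(1) by simp_all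
    have "t \<ge> 1"
      unfolding t_def using n params \<beta>(1) by (intro ge_one_powr_ge_zero divide_nonneg_nonneg) auto
    then have Nt: "N n \<ge> 1" "t / 2 \<le> real (N n)" "real (N n) \<le> 2 * t"
      using rounding_bounds[of t "N n"] N[OF n] by (simp_all add: t_def Let_def)
    have bias: "2 * (sqrt L * real (N n) powr (- \<gamma>) * sqrt K) \<le> (c0 * s) powr x"
    proof -
      have "real (N n) powr (- \<gamma>) \<le> (t / 2) powr (- \<gamma>)"
        using Nt \<open>t \<ge> 1\<close> params by (intro powr_mono2') auto
      also have "\<dots> = 2 powr \<gamma> * s powr x"
        using \<open>t \<ge> 1\<close> by (simp add: powr_divide powr_minus_divide ts(1)[symmetric])
      finally have "2 * (sqrt L * real (N n) powr (- \<gamma>) * sqrt K) \<le> 2 * (sqrt L * (2 powr \<gamma> * s powr x) * sqrt K)"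
        using params Kpos by (intro mult_left_mono mult_right_mono) auto
      also have "\<dots> = B * s powr x" by (simp add: B_def)
      also have "\<dots> \<le> c0 powr x * s powr x" by (intro mult_right_mono c0) auto
      also have "\<dots> = (c0 * s) powr x" using c0 s by (simp add: powr_mult)
      finally show ?thesis .
    qed
    have noise: "C1\<^sup>2 * (real (N n) powr (2 * \<beta>) / n) \<le> c * (c0 * s) powr e"
    proof -
      have "real (N n) powr (2 * \<beta>) \<le> (2 * t) powr (2 * \<beta>)"
        using Nt \<beta>(1) by (intro powr_mono2) auto
      also have "\<dots> = 4 powr \<beta> * t powr (2 * \<beta>)"
      proof -
        have "(2::real) powr (2 * \<beta>) = (2 powr 2) powr \<beta>" by (simp only: powr_powr)
        also have "(2::real) powr 2 = 4" by simp
        finally show ?thesis using \<open>t \<ge> 1\<close> by (simp add: powr_mult)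
      qed
      finally have "C1\<^sup>2 * (real (N n) powr (2 * \<beta>) / n) \<le> C1\<^sup>2 * (4 powr \<beta> * t powr (2 * \<beta>) / n)"
        using n by (intro mult_left_mono divide_right_mono) auto
      also have "\<dots> = c * s powr e" by (simp add: c_def ts(2)[symmetric])
      also have "\<dots> \<le> c * (c0 * s) powr e"
        using c0 s e by (intro mult_left_mono powr_mono2) (auto simp: c_def)
      finally show ?thesis .
    qed
    from f have fD: "\<And>y. y \<le> M \<Longrightarrow> f y \<in> regular_densities \<nu>\<^sub>X \<phi> \<gamma> L"
        "\<And>y. y \<le> M \<Longrightarrow> prob_density \<nu>\<^sub>Z (A (f y))"
        "is_arg_min (risk loss (P f)) (\<lambda>g. g \<in> G) (gstar f)"
        "bernstein_class (P f) \<nu>Y \<kappa> \<kappa>\<^sub>0 {\<lambda>w. loss_of loss g w - loss_of loss (gstar f) w | g. g \<in> G}"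
        "\<And>m \<delta>. m > 0 \<Longrightarrow> 0 < \<delta> \<Longrightarrow> \<delta> < 1 \<or> \<delta> \<le> sqrt \<kappa>\<^sub>0 \<Longrightarrow>
          expected_modulus (Pt f) m \<nu>Y G (loss_of loss) (cut (N n)) \<delta>
          \<le> ennreal (C1 * (real (N n) powr \<beta> / sqrt (real m)) * \<delta> powr (1 - \<rho>))"
      using Nt(1) unfolding D_def by (auto simp: Suc_le_eq)
    \<comment> \<open>Points of the sample space have observations in \<open>Xt\<close> and labels
      in \<open>{..M}\<close>, which are exactly the samples on which \<open>ghat\<close> is
      prescribed.\<close>
    have arg: "is_arg_min (\<lambda>g. emp_mean n s (cut (N n) g)) (\<lambda>g. g \<in> G) (ghat n s)"
      if "s \<in> space (\<Pi>\<^sub>M i\<in>{..<n}. Pt f)" for s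
      using that unfolding space_PiM Pt_def Z.space_joint_law space_\<nu>Z by (rule ghat[OF n])
    have "(\<integral>s. risk loss (P f) (ghat n s) \<partial>(\<Pi>\<^sub>M i\<in>{..<n}. Pt f)) - risk loss (P f) (gstar f)
      \<le> (1 + 2 * (128 * K powr (1 - \<rho>) * 2 powr ((1 - \<rho>) / \<kappa>) * c)
          / (1 - 2 powr (- ((\<kappa> - 1 + \<rho>) / \<kappa>)))) * (c0 * s)"
      unfolding P_def Pt_def
    proof (rule excess_risk_bound[where \<gamma> = \<gamma> and L = L and \<kappa>\<^sub>0 = \<kappa>\<^sub>0 and \<beta> = \<beta> and N = "N n" and ?C1.0 = C1])
      show "0 < c0 * s" using c0 s by simp
      show "K = max \<kappa>\<^sub>0 (1 / 4)" by (fact K_def)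
      show "0 < n" "0 < N n" using n Nt by auto
      show "2 * (sqrt L * real (N n) powr - \<gamma> * sqrt K) \<le> (c0 * s) powr ((2 * \<kappa> - 1) / (2 * \<kappa>))"
        using bias unfolding x_def .
      show "C1\<^sup>2 * (real (N n) powr (2 * \<beta>) / real n) \<le> c * (c0 * s) powr ((2 * \<kappa> - 1 + \<rho>) / \<kappa>)"
        using noise unfolding e_def .
    qed (fact fD[unfolded P_def Pt_def \<nu>Y_def cut_def] params arg[unfolded Pt_def cut_def]
        ghat_meas[OF n f, unfolded P_def Pt_def])+
    then show ?thesis by (simp add: C_def s_def mult.assoc)
  qed
  show ?thesis
  proof (intro exI[of _ C] conjI C eventually_sequentiallyI[of 1] SUP_least)
    fix n :: nat and f assume "1 \<le> n" "f \<in> D"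
    from bound[OF this] show "ereal ((\<integral>s. risk loss (P f) (ghat n s) \<partial>(\<Pi>\<^sub>M i\<in>{..<n}. Pt f))
          - risk loss (P f) (gstar f))
        \<le> ereal (C * real n powr (- (\<kappa> * \<gamma> / (\<gamma> * (2 * \<kappa> + \<rho> - 1) + (2 * \<kappa> - 1) * \<beta>))))"
      by simp
  qed
qed

end
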